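(* Let $n \ge 3$, let $w_0 = n(n-1)\cdots 21$ (one-line notation) be the longest element of the symmetric group $\mathfrak{S}_n$, and let $\ell = \binom{n}{2}$. Choose a reduced word $i_1 i_2 \cdots i_\ell$ for $w_0$ uniformly at random, and let $C_n$ be the number of positions $k \in [1,\ell-1]$ with $|i_k - i_{k+1}| > 1$. Then $$E(C_n) = \binom{n}{2} - 1 - \frac{1}{3\binom{n}{2} 2^{2n-7}} \sum_{j=1}^{n-2} \frac{(2j-1)!!}{(j-1)!}\cdot \frac{(2j+1)!!}{j!}\cdot \frac{(2n-2j-3)!!}{(n-j-2)!}\cdot \frac{(2n-2j-1)!!}{(n-j-1)!}.$$
   Context: $\mathfrak{S}_n$ is generated by the simple reflections $s_1,\dots,s_{n-1}$, where $s_i$ interchanges $i$ and $i+1$. For $w \in \mathfrak{S}_n$, its length $\ell(w)$ is the minimal $m$ such that $w = s_{i_1}\cdots s_{i_m}$; for such a minimal product, the string $i_1 i_2\cdots i_m$ is a reduced word for $w$. The longest element $w_0$ has length $\binom{n}{2}$. A reduced word $i_1\cdots i_\ell$ "supports a commutation in position $k$" if $|i_k - i_{k+1}|>1$; $C_n$ counts such positions. Here $m!!$ denotes the double factorial (product of the positive odd integers up to $m$ for odd $m$), and $0! = 1$. *)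

theory Defs
  imports "HOL-Probability.Probability" "HOL-Combinatorics.Combinatorics"
begin

text \<open>Elements of the symmetric group on n letters are functions on \<^typ>\<open>nat\<close>
  permuting \<open>{1..n}\<close> and fixing every other number, as in the library's \<^const>\<open>permutes\<close>.\<close>

definition simple_reflection :: "nat \<Rightarrow> nat \<Rightarrow> nat" where
  "simple_reflection i = Transposition.transpose i (i + 1)"

definition word_product :: "nat list \<Rightarrow> nat \<Rightarrow> nat" where
  "word_product u = foldr (\<lambda>i p. simple_reflection i \<circ> p) u id"

definition words_for :: "nat \<Rightarrow> (nat \<Rightarrow> nat) \<Rightarrow> nat list set" where
  "words_for n w = {u. set u \<subseteq> {1..n - 1} \<and> word_product u = w}"

definition perm_length :: "nat \<Rightarrow> (nat \<Rightarrow> nat) \<Rightarrow> nat" where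
  "perm_length n w = (LEAST m. \<exists>u \<in> words_for n w. length u = m)"

definition reduced_words :: "nat \<Rightarrow> (nat \<Rightarrow> nat) \<Rightarrow> nat list set" where
  "reduced_words n w = {u \<in> words_for n w. length u = perm_length n w}"

definition longest_element :: "nat \<Rightarrow> nat \<Rightarrow> nat" where
  "longest_element n = (\<lambda>i. if i \<in> {1..n} then n + 1 - i else i)"

text \<open>Positions in a word are counted from 1, list indices from 0: the letter in position
  \<open>k\<close> of \<open>u\<close> is \<open>u ! (k - 1)\<close>.\<close>

definition supports_commutation :: "nat list \<Rightarrow> nat \<Rightarrow> bool" where
  "supports_commutation u k \<longleftrightarrow> \<bar>int (u ! (k - 1)) - int (u ! k)\<bar> > 1"

definition num_commutations :: "nat list \<Rightarrow> nat" where
  "num_commutations u = card {k \<in> {1..length u - 1}. supports_commutation u k}"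

definition double_fact :: "nat \<Rightarrow> nat" where
  "double_fact m = \<Prod>{k \<in> {1..m}. even k \<longleftrightarrow> even m}"

end

(* Let L be the linear functional on polynomials in x_1, ..., x_n that sends a monomial x^m to
   prod_{i<j} (l_i - l_j) / prod_i l_i!, where l_i = m_i + n - i. This number is antisymmetric in l, so
   all terms but one of a divided difference cancel and L (d_i x^m) arises from L x^m by lowering
   l_i by 1. The branching rule then gives sum_i L (d_i f) = deg f * L f whenever x_n does not occur in f.
   Applied to Schubert polynomials, this is the recursion that counts reduced words by their last
   letter, so the number of reduced words of w is l(w)! L(S_w), up to a constant factor.

   For w = w_0 the Schubert polynomial is the staircase monomial, with l_i = 2 (n - i), and fixing the
   last two letters j and k of a word lowers l_j and l_k by 1. Finally the rotation
   i_1 ... i_N -> (n - i_N) i_1 ... i_{N-1} permutes the reduced words of w_0, so a non-commutation is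
   equally likely in every position. *)

theory Submission
  imports Defs "HOL-Library.Poly_Mapping"
begin

section \<open>Divided differences\<close>

text \<open>The functional L is a composition of two classical maps: x^m goes to the quotient of
  alternants det(x_i^(l_j)) / det(x_i^(n-j)), which is 0 or a Schur polynomial up to sign, and the
  Schur polynomial of shape lambda goes to the number of standard tableaux of that shape divided by
  |lambda|!. Hence the antisymmetry in l and the branching rule. Two obstacles shape the proof. A
  monomial may have repeated l_i, where ratios of Vandermonde products are meaningless, so the
  branching identity must be extended to coinciding arguments. And Schubert polynomials must not
  depend on the chain of descents that defines them, which rests on the commutation and braid
  relations of divided differences. The constant factor L(S_id) is never evaluated, since it cancels
  in the expectation. That L does not vanish on the staircase monomial also shows that words of
  length n choose 2 for w_0 exist. In the final formula, the 3 comes from 5 * 7 * ... * (2j + 1) =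
  (2j + 1)!! / 3, the powers of 2 from products of even differences l_i - l_k, and one factor 2 from
  the two orders of a pair of neighbouring letters.\<close>

abbreviation "lookup \<equiv> Poly_Mapping.lookup"

text \<open>The type is at once a monoid algebra, which supplies products, and the free abelian
  group on the monomials, so that \<open>frag_extend\<close> defines a linear map by its values on
  monomials.\<close>

type_synonym mpoly = "(nat \<Rightarrow>\<^sub>0 nat) \<Rightarrow>\<^sub>0 int"

definition swap_mono :: "nat \<Rightarrow> (nat \<Rightarrow>\<^sub>0 nat) \<Rightarrow> (nat \<Rightarrow>\<^sub>0 nat)" where
  "swap_mono i m = Poly_Mapping.map_key (simple_reflection i) m"

definition swap_vars :: "nat \<Rightarrow> mpoly \<Rightarrow> mpoly" where
  "swap_vars i = frag_extend (\<lambda>m. frag_of (swap_mono i m))"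

definition set_exps :: "nat \<Rightarrow> (nat \<Rightarrow>\<^sub>0 nat) \<Rightarrow> nat \<Rightarrow> nat \<Rightarrow> (nat \<Rightarrow>\<^sub>0 nat)" where
  "set_exps i m c d = Poly_Mapping.update i c (Poly_Mapping.update (i + 1) d m)"

text \<open>The quotient of x^m - s_i x^m by x_i - x_(i+1), written out as a geometric sum so that
  exponents can be read off; \<open>div_diff_eq\<close> confirms that it is the quotient.\<close>

definition div_diff_mono :: "nat \<Rightarrow> (nat \<Rightarrow>\<^sub>0 nat) \<Rightarrow> mpoly" where
  "div_diff_mono i m = (let a = lookup m i; b = lookup m (i + 1) in
     if b \<le> a then \<Sum>c = b..<a. frag_of (set_exps i m c (a + b - 1 - c))
     else - (\<Sum>c = a..<b. frag_of (set_exps i m c (a + b - 1 - c))))"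

definition div_diff :: "nat \<Rightarrow> mpoly \<Rightarrow> mpoly" where
  "div_diff i = frag_extend (div_diff_mono i)"

definition Var :: "nat \<Rightarrow> mpoly" where
  "Var i = frag_of (Poly_Mapping.single i 1)"

lemma mpoly_induct [case_names zero monom diff]:
  fixes f :: mpoly
  assumes "P 0" "\<And>m. P (frag_of m)" "\<And>f g. P f \<Longrightarrow> P g \<Longrightarrow> P (f - g)"
  shows "P f"
  by (rule frag_induction[of f UNIV]) (use assms in auto)

lemma inj_simple_reflection [simp]: "inj (simple_reflection i)"
  by (simp add: simple_reflection_def)

lemma simple_reflection_involutive [simp]:
  "simple_reflection i (simple_reflection i k) = k"
  "simple_reflection i \<circ> simple_reflection i = id"
  by (auto simp: simple_reflection_def)

lemma simple_reflection_apply: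
  "simple_reflection i k = (if k = i then i + 1 else if k = i + 1 then i else k)"
  by (simp add: simple_reflection_def transpose_def)

lemma lookup_swap_mono [simp]: "lookup (swap_mono i m) k = lookup m (simple_reflection i k)"
  by (simp add: swap_mono_def map_key.rep_eq)

lemma lookup_set_exps [simp]:
  "lookup (set_exps i m c d) k = (if k = i then c else if k = i + 1 then d else lookup m k)"
  by (simp add: set_exps_def lookup_update)

lemma swap_vars_simps [simp]:
  "swap_vars i 0 = 0"
  "swap_vars i (frag_of m) = frag_of (swap_mono i m)"
  "swap_vars i (f - g) = swap_vars i f - swap_vars i g"
  by (simp_all add: swap_vars_def frag_extend_diff)

lemma div_diff_simps [simp]:
  "div_diff i 0 = 0"
  "div_diff i (frag_of m) = div_diff_mono i m"
  "div_diff i (f - g) = div_diff i f - div_diff i g"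
  by (simp_all add: div_diff_def frag_extend_diff)

lemma frag_of_mult: "frag_of m * frag_of m' = (frag_of (m + m') :: mpoly)"
  by (simp add: mult_single)

lemma swap_vars_Var_mult:
  "swap_vars i (Var k * f) = Var (simple_reflection i k) * swap_vars i f"
proof (induction f rule: mpoly_induct)
  case (monom m)
  have "swap_mono i (Poly_Mapping.single k 1 + m) =
      Poly_Mapping.single (simple_reflection i k) 1 + swap_mono i m"
    by (rule poly_mapping_eqI)
      (auto simp: lookup_add lookup_single when_def simple_reflection_apply)
  then show ?case
    by (simp add: Var_def frag_of_mult)
qed (simp_all add: algebra_simps)

lemma swap_vars_swap_vars [simp]: "swap_vars i (swap_vars i f) = f"
proof (induction f rule: mpoly_induct)
  case (monom m)
  have "swap_mono i (swap_mono i m) = m"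
    by (rule poly_mapping_eqI) simp
  then show ?case by simp
qed simp_all

lemma swap_vars_commute:
  assumes "i + 1 < j"
  shows "swap_vars i (swap_vars j f) = swap_vars j (swap_vars i f)"
proof (induction f rule: mpoly_induct)
  case (monom m)
  have "swap_mono i (swap_mono j m) = swap_mono j (swap_mono i m)"
    by (rule poly_mapping_eqI) (use assms in \<open>auto simp: simple_reflection_apply\<close>)
  then show ?case by simp
qed simp_all

lemma swap_vars_braid:
  "swap_vars i (swap_vars (i + 1) (swap_vars i f)) =
   swap_vars (i + 1) (swap_vars i (swap_vars (i + 1) f))"
proof (induction f rule: mpoly_induct)
  case (monom m)
  have "swap_mono i (swap_mono (i + 1) (swap_mono i m)) =
      swap_mono (i + 1) (swap_mono i (swap_mono (i + 1) m))"
    by (rule poly_mapping_eqI) (auto simp: simple_reflection_apply)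
  then show ?case by simp
qed simp_all

section \<open>Divided differences as exact quotients, and their relations\<close>

lemma Var_diff_nonzero: "i \<noteq> j \<Longrightarrow> Var i - Var j \<noteq> 0"
  unfolding Var_def
proof
  assume ij: "i \<noteq> j" "frag_of (Poly_Mapping.single i 1) - frag_of (Poly_Mapping.single j 1) = (0::mpoly)"
  then have "Poly_Mapping.single i (1::nat) = Poly_Mapping.single j 1"
    by (simp add: frag_of_eq)
  then have "lookup (Poly_Mapping.single i (1::nat)) i = lookup (Poly_Mapping.single j 1) i"
    by simp
  with ij show False by (simp add: lookup_single when_def)
qed

lemma div_diff_eq: "(Var i - Var (i + 1)) * div_diff i f = f - swap_vars i f"
proof (induction f rule: mpoly_induct)
  case (monom m)
  define a b where "a = lookup m i" and "b = lookup m (i + 1)"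
  \<comment> \<open>Multiplication by x_i - x_(i+1) telescopes along \<open>T\<close>, whose ends
    \<open>T a\<close> and \<open>T b\<close> are the monomial and its image under the swap.\<close>
  define T where "T c = (frag_of (set_exps i m c (a + b - c)) :: mpoly)" for c
  have step: "(Var i - Var (i + 1)) * frag_of (set_exps i m c (a + b - 1 - c)) = T (Suc c) - T c"
    if "c < a + b" for c
  proof -
    have "Poly_Mapping.single i 1 + set_exps i m c (a + b - 1 - c) = set_exps i m (Suc c) (a + b - Suc c)"
      by (rule poly_mapping_eqI) (auto simp: lookup_add lookup_single when_def)
    moreover have "Poly_Mapping.single (i + 1) 1 + set_exps i m c (a + b - 1 - c) = set_exps i m c (a + b - c)"
      using that by (intro poly_mapping_eqI) (auto simp: lookup_add lookup_single when_def)
    ultimately show ?thesis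
      by (simp add: Var_def frag_of_mult left_diff_distrib T_def)
  qed
  have sum: "(Var i - Var (i + 1)) * (\<Sum>c = p..<q. frag_of (set_exps i m c (a + b - 1 - c))) = T q - T p"
    if "p \<le> q" "q \<le> a + b" for p q
  proof -
    have "(Var i - Var (i + 1)) * (\<Sum>c = p..<q. frag_of (set_exps i m c (a + b - 1 - c))) =
        (\<Sum>c = p..<q. T (Suc c) - T c)"
      unfolding sum_distrib_left using that by (intro sum.cong refl step) auto
    then show ?thesis using that by (simp add: sum_Suc_diff')
  qed
  have "set_exps i m a b = m" "set_exps i m b a = swap_mono i m"
    by (rule poly_mapping_eqI; auto simp: a_def b_def simple_reflection_apply)+
  then have T: "T a = frag_of m" "T b = frag_of (swap_mono i m)"
    by (simp_all add: T_def)
  show ?case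
  proof (cases "b \<le> a")
    case True
    then show ?thesis
      using sum[of b a] by (simp add: div_diff_mono_def T flip: a_def[simplified] b_def[simplified])
  next
    case False
    then show ?thesis
      using sum[of a b] by (simp add: div_diff_mono_def T Let_def flip: a_def[simplified] b_def[simplified])
  qed
next
  case (diff f g)
  then show ?case
    by (simp only: div_diff_simps swap_vars_simps right_diff_distrib[of "Var i - Var (i + 1)"]) simp
qed simp

text \<open>Polynomials form an integral domain, so every relation between divided differences can
  be proved after clearing denominators.\<close>

lemma mult_Var_diff_cancel:
  fixes f g :: mpoly
  assumes "(Var i - Var j) * f = (Var i - Var j) * g" "i \<noteq> j"
  shows "f = g"
  using assms Var_diff_nonzero by simp

lemma swap_vars_Var_diff_mult:
  "swap_vars i ((Var j - Var k) * f) =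
   (Var (simple_reflection i j) - Var (simple_reflection i k)) * swap_vars i f"
  by (simp add: left_diff_distrib swap_vars_Var_mult)

text \<open>Numerator and denominator of the quotient both change sign under the swap.\<close>

lemma swap_vars_div_diff: "swap_vars i (div_diff i f) = div_diff i f"
proof -
  have "(Var (i + 1) - Var i) * swap_vars i (div_diff i f) =
      swap_vars i ((Var i - Var (i + 1)) * div_diff i f)"
    by (simp only: swap_vars_Var_diff_mult) (simp add: simple_reflection_apply)
  also have "\<dots> = - ((Var i - Var (i + 1)) * div_diff i f)"
    unfolding div_diff_eq by simp
  also have "\<dots> = (Var (i + 1) - Var i) * div_diff i f"
    by (simp add: left_diff_distrib)
  finally show ?thesis by (rule mult_Var_diff_cancel) simp
qed

lemma div_diff_div_diff [simp]: "div_diff i (div_diff i f) = 0"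
  by (rule mult_Var_diff_cancel[of i "i + 1"]) (simp_all only: div_diff_eq swap_vars_div_diff, simp_all)

lemma div_diff_commute:
  assumes "i + 1 < j"
  shows "div_diff i (div_diff j f) = div_diff j (div_diff i f)"
proof -
  \<comment> \<open>With both denominators cleared, what remains is the signed sum over the group
    generated by the two swaps. It is symmetric in \<open>i\<close> and \<open>j\<close>, hence
    stated for either order and used twice.\<close>
  have A: "(Var j - Var (j + 1)) * ((Var i - Var (i + 1)) * div_diff i (div_diff j f)) =
      f - swap_vars j f - (swap_vars i f - swap_vars i (swap_vars j f))"
    if "i + 1 < j \<or> j + 1 < i" for i j
  proof -
    have "(Var j - Var (j + 1)) * swap_vars i (div_diff j f) =
        swap_vars i ((Var j - Var (j + 1)) * div_diff j f)"
      using that by (auto simp: swap_vars_Var_diff_mult simple_reflection_apply)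
    then have "(Var j - Var (j + 1)) * swap_vars i (div_diff j f) = swap_vars i f - swap_vars i (swap_vars j f)"
      by (simp only: div_diff_eq swap_vars_simps)
    then show ?thesis
      by (simp only: div_diff_eq right_diff_distrib)
  qed
  have "(Var j - Var (j + 1)) * ((Var i - Var (i + 1)) * div_diff i (div_diff j f)) =
      (Var i - Var (i + 1)) * ((Var j - Var (j + 1)) * div_diff j (div_diff i f))"
    using assms by (simp only: A swap_vars_commute[OF assms] simp_thms) simp
  then have "(Var i - Var (i + 1)) * ((Var j - Var (j + 1)) * div_diff i (div_diff j f)) =
      (Var i - Var (i + 1)) * ((Var j - Var (j + 1)) * div_diff j (div_diff i f))"
    by (simp only: mult.left_commute[of "Var j - Var (j + 1)"])
  then have "(Var j - Var (j + 1)) * div_diff i (div_diff j f) = (Var j - Var (j + 1)) * div_diff j (div_diff i f)"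
    by (rule mult_Var_diff_cancel) simp
  then show ?thesis
    by (rule mult_Var_diff_cancel) simp
qed

text \<open>Multiplied by (a - b)(b - c)(a - c), either side becomes the signed sum
  \<open>?A\<close> of \<open>f\<close> over the six permutations of three consecutive
  variables.\<close>

lemma div_diff_braid:
  "div_diff i (div_diff (i + 1) (div_diff i f)) = div_diff (i + 1) (div_diff i (div_diff (i + 1) f))"
proof -
  define a b c where abc: "a = Var i" "b = Var (i + 1)" "c = Var (i + 2)"
  define s t where st: "s = swap_vars i" "t = swap_vars (i + 1)"
  define d e where de: "d = div_diff i" "e = div_diff (i + 1)"
  have D: "(a - b) * d g = g - s g" "(b - c) * e g = g - t g" for g
    using div_diff_eq[of i g] div_diff_eq[of "i + 1" g] by (simp_all add: abc st de)
  have diff: "s (g - h) = s g - s h" "t (g - h) = t g - t h" for g h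
    by (simp_all add: st)
  have s: "s ((a - b) * g) = (b - a) * s g" "s ((b - c) * g) = (a - c) * s g" "s ((a - c) * g) = (b - c) * s g"
    and t: "t ((a - b) * g) = (a - c) * t g" "t ((b - c) * g) = (c - b) * t g" "t ((a - c) * g) = (a - b) * t g" for g
    unfolding abc st swap_vars_Var_diff_mult by (simp_all add: simple_reflection_apply)
  have inv: "s (d g) = d g" "t (e g) = e g" for g
    by (simp_all only: st de swap_vars_div_diff)
  have sts: "s (t (s f)) = t (s (t f))"
    unfolding st by (rule swap_vars_braid)
  \<comment> \<open>A swap moves the denominators too: \<open>t\<close> turns a - b into a - c, and
    \<open>s\<close> turns b - c into a - c.\<close>
  have l1: "(a - c) * t (d g) = t g - t (s g)" for g
    using arg_cong[OF D(1)[of g], of t] by (simp only: t diff)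
  have r1: "(a - c) * s (e g) = s g - s (t g)" for g
    using arg_cong[OF D(2)[of g], of s] by (simp only: s diff)
  have l2: "(b - c) * s (t (d f)) = s (t f) - s (t (s f))"
    using arg_cong[OF l1, of s] by (simp only: s diff)
  have r2: "(a - b) * t (s (e f)) = t (s f) - t (s (t f))"
    using arg_cong[OF r1, of t] by (simp only: t diff)
  let ?A = "f - s f - t f + s (t f) + t (s f) - s (t (s f))"
  have "(a - c) * ((b - c) * ((a - b) * d (e (d f)))) =
      (a - c) * ((b - c) * e (d f)) - (b - c) * ((a - c) * s (e (d f)))"
    unfolding D(1)[of "e (d f)"] by (simp only: right_diff_distrib mult.left_commute)
  also have "\<dots> = (a - c) * (d f - t (d f)) - (b - c) * (d f - s (t (d f)))"
    by (simp only: D(2) r1 inv)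
  also have "\<dots> = (a - b) * d f - (a - c) * t (d f) + (b - c) * s (t (d f))"
    by (simp add: algebra_simps)
  also have "\<dots> = ?A"
    unfolding D l1 l2 by simp
  finally have 1: "(a - c) * ((b - c) * ((a - b) * d (e (d f)))) = ?A" .
  have "(a - c) * ((a - b) * ((b - c) * e (d (e f)))) =
      (a - c) * ((a - b) * d (e f)) - (a - b) * ((a - c) * t (d (e f)))"
    unfolding D(2)[of "d (e f)"] by (simp only: right_diff_distrib mult.left_commute)
  also have "\<dots> = (a - c) * (e f - s (e f)) - (a - b) * (e f - t (s (e f)))"
    by (simp only: D(1) l1 inv)
  also have "\<dots> = (b - c) * e f - (a - c) * s (e f) + (a - b) * t (s (e f))"
    by (simp add: algebra_simps)
  also have "\<dots> = ?A"
    unfolding D r1 r2 sts by simp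
  finally have 2: "(a - c) * ((a - b) * ((b - c) * e (d (e f)))) = ?A" .
  have "(a - c) * ((a - b) * ((b - c) * d (e (d f)))) = (a - c) * ((a - b) * ((b - c) * e (d (e f))))"
    unfolding 2 1[symmetric] by (simp only: mult.left_commute[of "a - b" "b - c"])
  then have "(a - b) * ((b - c) * d (e (d f))) = (a - b) * ((b - c) * e (d (e f)))"
    unfolding abc by (rule mult_Var_diff_cancel) simp
  then have "(b - c) * d (e (d f)) = (b - c) * e (d (e f))"
    unfolding abc by (rule mult_Var_diff_cancel) simp
  then have "d (e (d f)) = e (d (e f))"
    unfolding abc by (rule mult_Var_diff_cancel) simp
  then show ?thesis by (simp only: de)
qed

section \<open>The branching functional\<close>

definition vandermonde :: "nat \<Rightarrow> (nat \<Rightarrow> real) \<Rightarrow> real" where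
  "vandermonde n x = (\<Prod>j = 1..n. \<Prod>i = 1..<j. x i - x j)"

lemma vandermonde_Suc:
  "vandermonde (Suc n) x = vandermonde n x * (\<Prod>i = 1..n. x i - x (Suc n))"
  by (simp add: vandermonde_def atLeastLessThanSuc_atLeastAtMost)

lemma vandermonde_cong: "(\<And>i. i \<in> {1..n} \<Longrightarrow> x i = y i) \<Longrightarrow> vandermonde n x = vandermonde n y"
  unfolding vandermonde_def by (intro prod.cong refl) auto

lemma vandermonde_nonzero: "inj_on x {1..n} \<Longrightarrow> vandermonde n x \<noteq> 0"
  unfolding vandermonde_def
  by (subst prod_zero_iff, simp)+ (force dest: inj_onD)

text \<open>Only the factors that contain \<open>x j\<close> change, and writing all of them with
  \<open>x j\<close> in front costs the same sign on both sides. The form without division also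
  covers coinciding arguments.\<close>

lemma vandermonde_fun_upd:
  assumes "j \<in> {1..n}"
  shows "vandermonde n (x(j := y)) * (\<Prod>i \<in> {1..n} - {j}. x j - x i) =
         vandermonde n x * (\<Prod>i \<in> {1..n} - {j}. y - x i)"
  using assms
proof (induction n)
  case (Suc n)
  show ?case
  proof (cases "j = Suc n")
    case True
    have V: "vandermonde (Suc n) z = vandermonde n z * (\<Prod>i = 1..n. z i - z j)" for z
      by (simp add: vandermonde_Suc True)
    have "vandermonde n (x(j := y)) = vandermonde n x"
      by (rule vandermonde_cong) (use True in auto)
    moreover have "(\<Prod>i = 1..n. (x(j := y)) i - y) = (\<Prod>i = 1..n. x i - y)"
      by (rule prod.cong) (use True in auto)
    moreover have "{1..Suc n} - {j} = {1..n}" using True by auto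
    moreover have "(\<Prod>i = 1..n. x i - y) * (\<Prod>i = 1..n. x j - x i) =
        (\<Prod>i = 1..n. x i - x j) * (\<Prod>i = 1..n. y - x i)"
      unfolding prod.distrib[symmetric] by (intro prod.cong refl) (simp add: algebra_simps)
    ultimately show ?thesis
      unfolding V by (simp only: fun_upd_same mult.assoc)
  next
    case False
    then have j: "j \<in> {1..n}" using Suc.prems by auto
    have set: "{1..Suc n} - {j} = insert (Suc n) ({1..n} - {j})" using False by auto
    have split: "(\<Prod>i = 1..n. g i) = g j * (\<Prod>i \<in> {1..n} - {j}. g i)" for g :: "nat \<Rightarrow> real"
      using j by (simp add: prod.remove)
    have "(\<Prod>i \<in> {1..n} - {j}. (x(j := y)) i - x (Suc n)) = (\<Prod>i \<in> {1..n} - {j}. x i - x (Suc n))"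
      by (intro prod.cong) auto
    moreover have "(x(j := y)) (Suc n) = x (Suc n)" "(x(j := y)) j = y"
      using False by auto
    ultimately have "vandermonde (Suc n) (x(j := y)) * (\<Prod>i \<in> {1..Suc n} - {j}. x j - x i) =
        (vandermonde n (x(j := y)) * (\<Prod>i \<in> {1..n} - {j}. x j - x i)) *
        ((y - x (Suc n)) * (\<Prod>i \<in> {1..n} - {j}. x i - x (Suc n)) * (x j - x (Suc n)))"
      unfolding vandermonde_Suc set split[of "\<lambda>i. (x(j := y)) i - (x(j := y)) (Suc n)"]
      by (simp only: prod.insert finite_Diff finite_atLeastAtMost) simp
    also have "\<dots> = vandermonde (Suc n) x * (\<Prod>i \<in> {1..Suc n} - {j}. y - x i)"
      unfolding Suc.IH[OF j] vandermonde_Suc set split[of "\<lambda>i. x i - x (Suc n)"] by simp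
    finally show ?thesis .
  qed
qed simp

lemma simple_reflection_permutes:
  "i \<in> S \<Longrightarrow> i + 1 \<in> S \<Longrightarrow> simple_reflection i permutes S"
  unfolding simple_reflection_def by (rule permutes_swap_id)

lemma vandermonde_swap:
  assumes "1 \<le> i" "i < n"
  shows "vandermonde n (x \<circ> simple_reflection i) = - vandermonde n x"
  using assms
proof (induction n)
  case (Suc n)
  let ?y = "x \<circ> simple_reflection i"
  show ?case
  proof (cases "i = n")
    case True
    then obtain k where k: "n = Suc k" using Suc.prems by (cases n) auto
    have "vandermonde k ?y = vandermonde k x"
      by (rule vandermonde_cong) (use True k in \<open>auto simp: simple_reflection_apply\<close>)
    moreover have "(\<Prod>j = 1..k. ?y j - c) = (\<Prod>j = 1..k. x j - c)" for c
      by (intro prod.cong refl) (use True k in \<open>auto simp: simple_reflection_apply\<close>)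
    moreover have "?y (Suc k) = x (Suc (Suc k))" "?y (Suc (Suc k)) = x (Suc k)"
      using True k by (auto simp: simple_reflection_apply)
    ultimately show ?thesis
      unfolding k vandermonde_Suc by (simp only: prod.cl_ivl_Suc) (simp add: algebra_simps)
  next
    case False
    then have i: "i < n" using Suc.prems by simp
    have "simple_reflection i permutes {1..n}"
      using i Suc.prems by (intro simple_reflection_permutes) auto
    then have "(\<Prod>j = 1..n. x j - x (Suc n)) = (\<Prod>j = 1..n. ?y j - x (Suc n))"
      by (subst prod.permute) (auto simp: o_def)
    moreover have "?y (Suc n) = x (Suc n)"
      using i by (simp add: simple_reflection_apply)
    ultimately show ?thesis
      using Suc.IH i Suc.prems by (simp add: vandermonde_Suc)
  qed
qed simp

section \<open>Lagrange weights: the factors by which a Vandermonde product changes when one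
  argument drops by 1\<close>

definition lagrange_weight :: "('a \<Rightarrow> real) \<Rightarrow> 'a set \<Rightarrow> 'a \<Rightarrow> real" where
  "lagrange_weight x I i = (\<Prod>j \<in> I - {i}. 1 - 1 / (x i - x j))"

lemma lagrange_weight_insert:
  assumes "finite I" "k \<notin> I"
  shows "i \<in> I \<Longrightarrow> lagrange_weight x (insert k I) i = lagrange_weight x I i * (1 - 1 / (x i - x k))"
    and "lagrange_weight x (insert k I) k = (\<Prod>j \<in> I. 1 - 1 / (x k - x j))"
proof -
  assume "i \<in> I"
  then have "insert k I - {i} = insert k (I - {i})" using assms by auto
  then show "lagrange_weight x (insert k I) i = lagrange_weight x I i * (1 - 1 / (x i - x k))"
    using assms by (simp add: lagrange_weight_def)
qed (use assms in \<open>simp add: lagrange_weight_def\<close>)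

text \<open>Up to sign the weights are the residues at the poles \<open>y = x i\<close>. Evaluated
  at a new point \<open>x k\<close>, the expansion gives the weight of that point in terms of the
  old weights, which drives the two summations below.\<close>

lemma prod_partial_fractions:
  assumes "finite I" "inj_on x I" "y \<notin> x ` I"
  shows "(\<Prod>j \<in> I. 1 - 1 / (y - x j)) = 1 - (\<Sum>i \<in> I. lagrange_weight x I i / (y - x i))"
  using assms
proof (induction I arbitrary: y rule: finite_induct)
  case (insert k I)
  define c where "c = lagrange_weight x I"
  have y: "y \<noteq> x k" "\<And>i. i \<in> I \<Longrightarrow> y \<noteq> x i" and k: "x k \<notin> x ` I" "\<And>i. i \<in> I \<Longrightarrow> x k \<noteq> x i"
    using insert.prems insert.hyps by (auto simp: inj_on_def)
  \<comment> \<open>With u = x i - x k and v = y - x k this is 1/(u(v - u)) = (1/v)(1/u + 1/(v -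
    u)). The resulting sums are those of the induction hypothesis at \<open>y\<close> and at
    \<open>x k\<close>.\<close>
  have "(\<Sum>i \<in> I. c i * (1 - 1 / (x i - x k)) / (y - x i)) =
      (\<Sum>i \<in> I. c i / (y - x i) - c i / (y - x i) * (1 / (y - x k)) - c i / (x k - x i) * (-1 / (y - x k)))"
  proof (intro sum.cong refl)
    fix i assume "i \<in> I"
    then have "x i - x k \<noteq> 0" "y - x k \<noteq> 0" "y - x k \<noteq> x i - x k"
      using y k by fastforce+
    then have "c i * (1 - 1 / u) / (v - u) = c i / (v - u) - c i / (v - u) * (1 / v) - c i / (- u) * (- 1 / v)"
      if "u = x i - x k" "v = y - x k" for u v
      unfolding that[symmetric] by (simp add: divide_simps) (simp add: algebra_simps)
    from this[OF refl refl] show "c i * (1 - 1 / (x i - x k)) / (y - x i) =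
        c i / (y - x i) - c i / (y - x i) * (1 / (y - x k)) - c i / (x k - x i) * (-1 / (y - x k))"
      by simp
  qed
  also have "\<dots> = (\<Sum>i \<in> I. c i / (y - x i)) - (\<Sum>i \<in> I. c i / (y - x i)) * (1 / (y - x k))
      - (\<Sum>i \<in> I. c i / (x k - x i)) * (-1 / (y - x k))"
    by (simp only: sum_subtractf sum_distrib_right)
  finally have *: "(\<Sum>i \<in> I. lagrange_weight x (insert k I) i / (y - x i)) = \<dots>"
    using insert.hyps by (simp add: lagrange_weight_insert c_def)
  have prod: "(\<Prod>j \<in> insert k I. 1 - 1 / (y - x j)) = (1 - 1 / (y - x k)) * (1 - (\<Sum>i \<in> I. c i / (y - x i)))"
    using insert.hyps insert.prems insert.IH[of y] by (simp add: c_def)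
  have weight: "lagrange_weight x (insert k I) k = 1 - (\<Sum>i \<in> I. c i / (x k - x i))"
    using insert.hyps insert.prems insert.IH[of "x k"] k by (simp add: lagrange_weight_insert c_def)
  show ?case
    unfolding sum.insert[OF insert.hyps] * prod weight by (simp add: algebra_simps diff_divide_distrib)
qed simp

text \<open>This is the comparison of the coefficients of 1/y in
  \<open>prod_partial_fractions\<close> as y grows. In the induction, the correction terms of the
  old weights cancel against the weight of the new point.\<close>

lemma sum_lagrange_weight:
  assumes "finite I" "inj_on x I"
  shows "(\<Sum>i \<in> I. lagrange_weight x I i) = card I"
  using assms
proof (induction I rule: finite_induct)
  case (insert k I)
  have k: "x k \<notin> x ` I" using insert.prems insert.hyps by auto
  have "(\<Sum>i \<in> I. lagrange_weight x (insert k I) i) =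
      (\<Sum>i \<in> I. lagrange_weight x I i + lagrange_weight x I i / (x k - x i))"
  proof (intro sum.cong refl)
    fix i assume i: "i \<in> I"
    then have "x i - x k \<noteq> 0" "x k - x i \<noteq> 0" using k by (auto simp: image_iff)
    then show "lagrange_weight x (insert k I) i = lagrange_weight x I i + lagrange_weight x I i / (x k - x i)"
      using insert.hyps i by (simp add: lagrange_weight_insert field_simps)
  qed
  then show ?case
    using insert k by (simp add: lagrange_weight_insert prod_partial_fractions sum.distrib)
qed simp

text \<open>Likewise the comparison of the coefficients of 1/y^2; the subtracted binomial
  coefficient counts the pairs of factors that each contribute 1/y.\<close>

lemma sum_mult_lagrange_weight:
  assumes "finite I" "inj_on x I"
  shows "(\<Sum>i \<in> I. x i * lagrange_weight x I i) = (\<Sum>i \<in> I. x i) - real (card I) * (real (card I) - 1) / 2"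
  using assms
proof (induction I rule: finite_induct)
  case (insert k I)
  define c where "c = lagrange_weight x I"
  have k: "x k \<notin> x ` I" using insert.prems insert.hyps by auto
  have "(\<Sum>i \<in> I. x i * lagrange_weight x (insert k I) i) =
      (\<Sum>i \<in> I. x i * c i - c i + x k * (c i / (x k - x i)))"
  proof (intro sum.cong refl)
    fix i assume i: "i \<in> I"
    then have "x i - x k \<noteq> 0" "x k - x i \<noteq> 0" using k by (auto simp: image_iff)
    then show "x i * lagrange_weight x (insert k I) i = x i * c i - c i + x k * (c i / (x k - x i))"
      using insert.hyps i by (simp add: lagrange_weight_insert c_def field_simps)
  qed
  also have "\<dots> = (\<Sum>i \<in> I. x i * c i) - card I + x k * (\<Sum>i \<in> I. c i / (x k - x i))"
    using insert.hyps insert.prems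
    by (simp add: sum.distrib sum_subtractf sum_lagrange_weight c_def sum_distrib_left)
  finally have *: "(\<Sum>i \<in> I. x i * lagrange_weight x (insert k I) i) = \<dots>" .
  have "lagrange_weight x (insert k I) k = 1 - (\<Sum>i \<in> I. c i / (x k - x i))"
    using insert k by (simp add: lagrange_weight_insert(2) prod_partial_fractions c_def)
  moreover have "(\<Sum>i \<in> I. x i * c i) = (\<Sum>i \<in> I. x i) - real (card I) * (real (card I) - 1) / 2"
    using insert by (simp add: c_def)
  ultimately have "(\<Sum>i \<in> insert k I. x i * lagrange_weight x (insert k I) i) =
      x k + (\<Sum>i \<in> I. x i) - real (card I) * (real (card I) - 1) / 2 - card I"
    using insert.hyps * by (simp add: right_diff_distrib)
  also have "\<dots> = (\<Sum>i \<in> insert k I. x i) - real (card (insert k I)) * (real (card (insert k I)) - 1) / 2"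
    using insert.hyps by (simp add: algebra_simps diff_divide_distrib add_divide_distrib)
  finally show ?case .
qed simp

lemma vandermonde_lower_distinct:
  assumes "inj_on x {1..n}"
  shows "(\<Sum>i = 1..n. x i * vandermonde n (x(i := x i - 1))) =
         ((\<Sum>i = 1..n. x i) - real n * (real n - 1) / 2) * vandermonde n x"
proof -
  have "x i * vandermonde n (x(i := x i - 1)) = x i * lagrange_weight x {1..n} i * vandermonde n x"
    if i: "i \<in> {1..n}" for i
  proof -
    have ne: "x i - x j \<noteq> 0" if "j \<in> {1..n} - {i}" for j
      using that i inj_onD[OF assms, of i j] by auto
    then have "lagrange_weight x {1..n} i = (\<Prod>j \<in> {1..n} - {i}. (x i - 1 - x j) / (x i - x j))"
      unfolding lagrange_weight_def by (intro prod.cong refl) (simp add: field_simps)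
    moreover have "(\<Prod>j \<in> {1..n} - {i}. x i - x j) \<noteq> 0"
      using ne by (subst prod_zero_iff) auto
    moreover from this have "vandermonde n (x(i := x i - 1)) =
        vandermonde n x * (\<Prod>j \<in> {1..n} - {i}. x i - 1 - x j) / (\<Prod>j \<in> {1..n} - {i}. x i - x j)"
      using vandermonde_fun_upd[OF i, of x "x i - 1"] by (simp add: eq_divide_eq)
    ultimately show ?thesis by (simp add: prod_dividef)
  qed
  then have "(\<Sum>i = 1..n. x i * vandermonde n (x(i := x i - 1))) =
      (\<Sum>i = 1..n. x i * lagrange_weight x {1..n} i) * vandermonde n x"
    unfolding sum_distrib_right by (rule sum.cong[OF refl])
  then show ?thesis
    using sum_mult_lagrange_weight[OF _ assms] by simp
qed

text \<open>Coinciding arguments are separated by the perturbation \<open>x i + t i\<close>, and \<open>t\<close> tends to 0.\<close>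

lemma vandermonde_lower:
  "(\<Sum>i = 1..n. x i * vandermonde n (x(i := x i - 1))) =
   ((\<Sum>i = 1..n. x i) - real n * (real n - 1) / 2) * vandermonde n x"
proof -
  \<comment> \<open>Repeated values cannot be excluded: two entries of \<open>shifted n m\<close>
    may agree. Both sides are continuous in \<open>t\<close>, so agreement for small positive
    \<open>t\<close> suffices.\<close>
  define z where "z t i = x i + t * real i" for t i
  define A where "A t = (\<Sum>i = 1..n. z t i * vandermonde n ((z t)(i := z t i - 1)))" for t
  define B where "B t = ((\<Sum>i = 1..n. z t i) - real n * (real n - 1) / 2) * vandermonde n (z t)" for t
  have "\<forall>\<^sub>F t in at_right 0. z t i \<noteq> z t j" if "i \<noteq> j" for i j
  proof (cases "x i = x j")
    case True
    then show ?thesis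
      using that by (auto simp: z_def eventually_at_right_field intro!: exI[of _ 1])
  next
    case False
    have "isCont (\<lambda>t. z t i - z t j) 0" unfolding z_def by (intro continuous_intros)
    then have "((\<lambda>t. z t i - z t j) \<longlongrightarrow> x i - x j) (at 0)"
      by (simp add: isCont_def z_def)
    then have "((\<lambda>t. z t i - z t j) \<longlongrightarrow> x i - x j) (at_right 0)"
      by (rule filterlim_mono) (auto intro: at_le)
    then have "\<forall>\<^sub>F t in at_right 0. z t i - z t j \<noteq> 0"
      using False by (intro tendsto_imp_eventually_ne) auto
    then show ?thesis by simp
  qed
  then have "\<forall>\<^sub>F t in at_right 0. \<forall>p \<in> {1..n} \<times> {1..n}. fst p \<noteq> snd p \<longrightarrow> z t (fst p) \<noteq> z t (snd p)"
    by (intro eventually_ball_finite) auto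
  then have ev: "\<forall>\<^sub>F t in at_right 0. A t = B t"
  proof eventually_elim
    case (elim t)
    then have "inj_on (z t) {1..n}" by (auto simp: inj_on_def)
    then show ?case unfolding A_def B_def by (rule vandermonde_lower_distinct)
  qed
  have cont: "isCont (\<lambda>t. (if k = i then z t k - d else z t k)) 0" for k i d
    unfolding z_def by (cases "k = i") (auto intro!: continuous_intros)
  have zi: "isCont (\<lambda>t. z t i) 0" for i
    unfolding z_def by (intro continuous_intros)
  have vd: "isCont (\<lambda>t. vandermonde n (\<lambda>k. if k = i then z t k - d else z t k)) 0" for i d
    unfolding vandermonde_def by (intro continuous_prod continuous_diff cont)
  have upd: "(z t)(i := z t i - d) = (\<lambda>k. if k = i then z t k - d else z t k)" for t i d
    by auto
  have "isCont A 0"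
    unfolding A_def upd by (intro continuous_sum continuous_mult zi vd)
  moreover have "isCont B 0"
    unfolding B_def vandermonde_def
    by (intro continuous_mult continuous_diff continuous_sum continuous_prod continuous_const zi)
  ultimately have lim: "(A \<longlongrightarrow> A 0) (at_right 0)" "(B \<longlongrightarrow> B 0) (at_right 0)"
    unfolding isCont_def by (blast intro: filterlim_mono at_le)+
  have "A 0 = B 0"
    using tendsto_unique[OF trivial_limit_at_right_real lim(1)] lim(2) tendsto_cong[OF ev] by blast
  moreover have "z 0 = x" by (simp add: z_def fun_eq_iff)
  ultimately show ?thesis by (simp add: A_def B_def)
qed

text \<open>For \<open>l = \<lambda> + (n - 1, \<dots>, 0)\<close> this is the number of standard tableaux of shape \<open>\<lambda>\<close>, divided by the
  factorial of the size of \<open>\<lambda>\<close> (Frobenius).\<close>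

definition frobenius_weight :: "nat \<Rightarrow> (nat \<Rightarrow> nat) \<Rightarrow> real" where
  "frobenius_weight n l = vandermonde n (\<lambda>i. real (l i)) / (\<Prod>i = 1..n. fact (l i))"

lemma frobenius_weight_cong:
  "(\<And>i. i \<in> {1..n} \<Longrightarrow> l i = l' i) \<Longrightarrow> frobenius_weight n l = frobenius_weight n l'"
  unfolding frobenius_weight_def by (intro arg_cong2[of _ _ _ _ "(/)"] vandermonde_cong prod.cong) auto

lemma frobenius_weight_swap:
  assumes "1 \<le> i" "i < n"
  shows "frobenius_weight n (l \<circ> simple_reflection i) = - frobenius_weight n l"
proof -
  have "simple_reflection i permutes {1..n}"
    using assms by (intro simple_reflection_permutes) auto
  then have "(\<Prod>k = 1..n. fact (l k) :: real) = (\<Prod>k = 1..n. fact ((l \<circ> simple_reflection i) k))"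
    by (subst prod.permute) (auto simp: o_def)
  then show ?thesis
    using vandermonde_swap[OF assms, of "\<lambda>i. real (l i)"] by (simp add: frobenius_weight_def o_def)
qed

lemma prod_fact_lower:
  fixes l :: "nat \<Rightarrow> nat"
  assumes "i \<in> {1..n}" "0 < l i"
  shows "(\<Prod>k = 1..n. fact (l k) :: real) = real (l i) * (\<Prod>k = 1..n. fact ((l(i := l i - 1)) k))"
proof -
  have split: "(\<Prod>k = 1..n. g k) = g i * (\<Prod>k \<in> {1..n} - {i}. g k)" for g :: "nat \<Rightarrow> real"
    using assms by (simp add: prod.remove)
  have "(\<Prod>k \<in> {1..n} - {i}. fact ((l(i := l i - 1)) k) :: real) = (\<Prod>k \<in> {1..n} - {i}. fact (l k))"
    by (intro prod.cong) auto
  moreover have "fact (l i) = real (l i) * fact ((l(i := l i - 1)) i)"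
    using assms by (simp add: fact_reduce)
  ultimately show ?thesis
    unfolding split[of "\<lambda>k. fact (l k)"] split[of "\<lambda>k. fact ((l(i := l i - 1)) k)"] by (simp only: mult.assoc)
qed

text \<open>The factor \<open>l i\<close> arises from
  \<open>fact (l i) = l i * fact (l i - 1)\<close> and produces exactly the summands of
  \<open>vandermonde_lower\<close>.\<close>

lemma frobenius_weight_lower:
  assumes "i \<in> {1..n}" "0 < l i"
  shows "frobenius_weight n (l(i := l i - 1)) =
    real (l i) * vandermonde n ((\<lambda>k. real (l k))(i := real (l i) - 1)) / (\<Prod>k = 1..n. fact (l k))"
proof -
  have "vandermonde n (\<lambda>k. real ((l(i := l i - 1)) k)) = vandermonde n ((\<lambda>k. real (l k))(i := real (l i) - 1))"
    using assms by (intro vandermonde_cong) (auto simp: of_nat_diff)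
  then show ?thesis
    using assms unfolding prod_fact_lower[where l = l, OF assms] by (simp add: frobenius_weight_def del: fun_upd_apply)
qed

text \<open>This is the branching rule of Young's lattice.\<close>

lemma frobenius_weight_branching:
  "(\<Sum>i \<in> {i \<in> {1..n}. 0 < l i}. frobenius_weight n (l(i := l i - 1))) =
   ((\<Sum>i = 1..n. real (l i)) - real n * (real n - 1) / 2) * frobenius_weight n l"
proof -
  define x where "x = (\<lambda>i. real (l i))"
  have "(\<Sum>i \<in> {i \<in> {1..n}. 0 < l i}. frobenius_weight n (l(i := l i - 1))) =
      (\<Sum>i \<in> {i \<in> {1..n}. 0 < l i}. x i * vandermonde n (x(i := x i - 1)) / (\<Prod>k = 1..n. fact (l k)))"
    by (intro sum.cong refl) (use frobenius_weight_lower in \<open>auto simp: x_def\<close>)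
  \<comment> \<open>The indices with \<open>l i = 0\<close> may be added because the factor
    \<open>x i\<close> vanishes there. On the left they must stay excluded, since truncated
    subtraction would leave \<open>l\<close> unchanged.\<close>
  also have "\<dots> = (\<Sum>i = 1..n. x i * vandermonde n (x(i := x i - 1)) / (\<Prod>k = 1..n. fact (l k)))"
    by (rule sum.mono_neutral_left) (auto simp: x_def)
  finally show ?thesis
    unfolding sum_divide_distrib[symmetric] vandermonde_lower by (simp add: frobenius_weight_def x_def)
qed

section \<open>The functional on polynomials and its behaviour under divided differences\<close>

definition shifted :: "nat \<Rightarrow> (nat \<Rightarrow>\<^sub>0 nat) \<Rightarrow> nat \<Rightarrow> nat" where
  "shifted n m i = lookup m i + (n - i)"

definition poly_weight :: "nat \<Rightarrow> mpoly \<Rightarrow> real" where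
  "poly_weight n f = (\<Sum>m \<in> Poly_Mapping.keys f. of_int (lookup f m) * frobenius_weight n (shifted n m))"

lemma poly_weight_superset:
  assumes "finite S" "Poly_Mapping.keys f \<subseteq> S"
  shows "poly_weight n f = (\<Sum>m \<in> S. of_int (lookup f m) * frobenius_weight n (shifted n m))"
  unfolding poly_weight_def using assms by (intro sum.mono_neutral_left) (auto simp: in_keys_iff)

lemma poly_weight_simps [simp]:
  "poly_weight n 0 = 0"
  "poly_weight n (frag_of m) = frobenius_weight n (shifted n m)"
  "poly_weight n (f - g) = poly_weight n f - poly_weight n g"
proof -
  have "finite (Poly_Mapping.keys f \<union> Poly_Mapping.keys g)" by simp
  moreover have "Poly_Mapping.keys (f - g) \<subseteq> Poly_Mapping.keys f \<union> Poly_Mapping.keys g"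
    by (rule keys_diff)
  ultimately show "poly_weight n (f - g) = poly_weight n f - poly_weight n g"
    by (simp add: poly_weight_superset[where S = "Poly_Mapping.keys f \<union> Poly_Mapping.keys g"]
        lookup_minus left_diff_distrib sum_subtractf)
qed (simp_all add: poly_weight_def)

lemma poly_weight_uminus [simp]: "poly_weight n (- f) = - poly_weight n f"
  using poly_weight_simps(3)[of n 0 f] by simp

lemma poly_weight_add [simp]: "poly_weight n (f + g) = poly_weight n f + poly_weight n g"
  using poly_weight_simps(3)[of n f "- g"] by simp

lemma poly_weight_sum: "poly_weight n (sum f A) = (\<Sum>a \<in> A. poly_weight n (f a))"
  by (induction A rule: infinite_finite_induct) simp_all

text \<open>The antisymmetry of the weight cancels all but one term of the divided difference.\<close>

lemma poly_weight_div_diff_mono: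
  assumes i: "1 \<le> i" "i < n"
  shows "poly_weight n (div_diff_mono i m) =
    frobenius_weight n ((shifted n m)(i := shifted n m i - 1))"
proof -
  define a b where ab: "a = lookup m i" "b = lookup m (i + 1)"
  define h where "h c d = frobenius_weight n (shifted n (set_exps i m c d))" for c d
  have swap: "frobenius_weight n l = - frobenius_weight n l'"
    if "l i = l' (i + 1)" "l (i + 1) = l' i" "\<And>k. k \<noteq> i \<Longrightarrow> k \<noteq> i + 1 \<Longrightarrow> l k = l' k" for l l'
  proof -
    have "l = l' \<circ> simple_reflection i"
      using that by (auto simp: fun_eq_iff simple_reflection_apply)
    then show ?thesis using frobenius_weight_swap[OF i, of l'] by simp
  qed
  \<comment> \<open>The shift at \<open>i\<close> exceeds the one at \<open>i + 1\<close> by 1, so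
    exchanging the shifted values moves one unit between the exponents.\<close>
  have anti: "h c (Suc d) = - h d (Suc c)" for c d
    unfolding h_def by (rule swap) (use i in \<open>auto simp: shifted_def\<close>)
  \<comment> \<open>The terms \<open>c\<close> and \<open>p + q - 2 - c\<close> cancel by
    antisymmetry. Only \<open>c = q - 1\<close> has its partner outside the range.\<close>
  have tele: "(\<Sum>c = p..<q. h c (p + q - 1 - c)) = h (q - 1) p" if "p < q" for p q
  proof -
    obtain r where r: "q = Suc r" "p \<le> r" using \<open>p < q\<close> by (metis less_eq_Suc_le Suc_le_D Suc_le_mono)
    let ?S = "\<Sum>c = p..<r. h c (p + q - 1 - c)"
    have "?S = (\<Sum>c = p..<r. h (r + p - Suc c) (p + q - 1 - (r + p - Suc c)))"
      by (rule sum.atLeastLessThan_rev)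
    also have "\<dots> = (\<Sum>c = p..<r. - h c (p + q - 1 - c))"
    proof (intro sum.cong refl)
      fix c assume "c \<in> {p..<r}"
      then show "h (r + p - Suc c) (p + q - 1 - (r + p - Suc c)) = - h c (p + q - 1 - c)"
        using anti[of "r + p - Suc c" c] r by (simp add: Suc_diff_Suc add.commute[of r p])
    qed
    finally have "?S = 0" by (simp add: sum_negf)
    then show ?thesis using r by (simp add: sum.atLeastLessThan_Suc)
  qed
  have sum: "poly_weight n (\<Sum>c = p..<q. frag_of (set_exps i m c (a + b - 1 - c))) =
      (\<Sum>c = p..<q. h c (a + b - 1 - c))" for p q
    by (simp add: poly_weight_sum h_def)
  consider "b < a" | "a = b" | "a < b" by linarith
  then show ?thesis
  proof cases
    case 1
    then have "poly_weight n (div_diff_mono i m) = h (a - 1) b"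
      using tele[of b a] sum[of b a]
      by (simp add: div_diff_mono_def add.commute flip: ab[simplified])
    also have "\<dots> = frobenius_weight n ((shifted n m)(i := shifted n m i - 1))"
      unfolding h_def using 1 by (intro frobenius_weight_cong) (auto simp: shifted_def ab)
    finally show ?thesis .
  next
    \<comment> \<open>The divided difference is 0, and lowering entry \<open>i\<close> makes it
      equal to entry \<open>i + 1\<close>, where the antisymmetric weight vanishes.\<close>
    case 2
    have "frobenius_weight n ((shifted n m)(i := shifted n m i - 1)) =
        - frobenius_weight n ((shifted n m)(i := shifted n m i - 1))"
      by (rule swap) (use 2 i in \<open>auto simp: shifted_def ab\<close>)
    then show ?thesis
      using 2 by (simp add: div_diff_mono_def flip: ab[simplified])
  next
    \<comment> \<open>The surviving term has the two lowered entries in exchanged order, which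
      absorbs the minus sign.\<close>
    case 3
    then have "poly_weight n (div_diff_mono i m) = - h (b - 1) a"
      using tele[of a b] sum[of a b]
      by (simp add: div_diff_mono_def flip: ab[simplified])
    also have "\<dots> = frobenius_weight n ((shifted n m)(i := shifted n m i - 1))"
      unfolding h_def by (rule sym, rule swap) (use 3 i in \<open>auto simp: shifted_def ab\<close>)
    finally show ?thesis .
  qed
qed

lemma sum_diff_nat_real: "(\<Sum>i = 1..n. real (n - i)) = real n * (real n - 1) / 2"
proof (induction n)
  case (Suc n)
  have "(\<Sum>i = 1..Suc n. real (Suc n - i)) = (\<Sum>i = 1..n. real (n - i) + 1)"
    by (simp del: of_nat_diff) (rule sum.cong, auto)
  then show ?case using Suc by (simp add: sum.distrib field_simps del: of_nat_diff)
qed simp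

text \<open>If x_n is absent then \<open>shifted n m n = 0\<close>, so the branching sum has no term
  at \<open>n\<close> and runs over exactly the indices of the divided differences. Its factor is
  the degree, because the shifts add up to n(n - 1)/2.\<close>

lemma sum_poly_weight_div_diff:
  assumes n: "1 \<le> n"
    and keys: "Poly_Mapping.keys f \<subseteq> {m. (\<Sum>i = 1..n. lookup m i) = d \<and> lookup m n = 0}"
  shows "(\<Sum>i = 1..n - 1. poly_weight n (div_diff i f)) = real d * poly_weight n f"
  using keys
proof (induction f rule: frag_induction)
  case (one m)
  let ?l = "shifted n m"
  have pos: "{i \<in> {1..n}. 0 < ?l i} = {1..n - 1}"
    using n one by (auto simp: shifted_def le_less)
  have "(\<Sum>i = 1..n. real (?l i)) = real d + (\<Sum>i = 1..n. real (n - i))"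
    using one unfolding shifted_def of_nat_add sum.distrib by (auto simp del: of_nat_diff)
  then have "(\<Sum>i = 1..n - 1. frobenius_weight n (?l(i := ?l i - 1))) = real d * frobenius_weight n ?l"
    using frobenius_weight_branching[where n = n and l = ?l] unfolding pos sum_diff_nat_real by simp
  moreover have "(\<Sum>i = 1..n - 1. poly_weight n (div_diff i (frag_of m))) =
      (\<Sum>i = 1..n - 1. frobenius_weight n (?l(i := ?l i - 1)))"
    by (intro sum.cong refl) (use n in \<open>auto simp: poly_weight_div_diff_mono\<close>)
  ultimately show ?case by simp
qed (simp_all add: sum_subtractf right_diff_distrib)

section \<open>Schubert polynomials and reduced words\<close>

text \<open>The cardinality serves as the length throughout; \<open>perm_length\<close> itself is
  only computed for the longest element.\<close>

definition inversions :: "nat \<Rightarrow> (nat \<Rightarrow> nat) \<Rightarrow> (nat \<times> nat) set" where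
  "inversions n w = {(a, b). 1 \<le> a \<and> a < b \<and> b \<le> n \<and> w b < w a}"

lemma finite_inversions [simp]: "finite (inversions n w)"
  by (rule finite_subset[of _ "{1..n} \<times> {1..n}"]) (auto simp: inversions_def)

lemma card_inversions_le: "card (inversions n w) \<le> n * n"
  using card_mono[of "{1..n} \<times> {1..n}" "inversions n w"] by (force simp: inversions_def)

text \<open>The reflection preserves the order of every pair except (i, i + 1). It therefore carries
  the inversions of \<open>w\<close> to those of the product, and (i, i + 1) is the only new
  one.\<close>

lemma card_inversions_ascent:
  assumes i: "1 \<le> i" "i < n" and asc: "w i < w (i + 1)"
  shows "card (inversions n (w \<circ> simple_reflection i)) = Suc (card (inversions n w))"
proof -
  let ?s = "simple_reflection i"
  let ?\<phi> = "\<lambda>(a, b). (?s a, ?s b)"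
  have mono: "?s a < ?s b" if "a < b" "(a, b) \<noteq> (i, i + 1)" for a b
    using that by (auto simp: simple_reflection_apply)
  have range: "1 \<le> ?s a \<and> ?s a \<le> n" if "1 \<le> a" "a \<le> n" for a
    using that i by (auto simp: simple_reflection_apply)
  have "inversions n (w \<circ> ?s) = insert (i, i + 1) (?\<phi> ` inversions n w)"
  proof (intro equalityI subsetI)
    fix p assume p: "p \<in> inversions n (w \<circ> ?s)"
    obtain a b where ab: "p = (a, b)" by fastforce
    show "p \<in> insert (i, i + 1) (?\<phi> ` inversions n w)"
    proof (cases "p = (i, i + 1)")
      case False
      then have "(?s a, ?s b) \<in> inversions n w"
        using p range[of a] range[of b] mono[of a b] by (auto simp: inversions_def ab)
      moreover have "?\<phi> (?s a, ?s b) = p" by (simp add: ab)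
      ultimately show ?thesis by (metis imageI insertCI)
    qed simp
  next
    fix p assume "p \<in> insert (i, i + 1) (?\<phi> ` inversions n w)"
    then consider "p = (i, i + 1)" | a b where "(a, b) \<in> inversions n w" "p = (?s a, ?s b)"
      by auto
    then show "p \<in> inversions n (w \<circ> ?s)"
    proof cases
      case 1
      then show ?thesis using i asc by (auto simp: inversions_def simple_reflection_apply)
    next
      case (2 a b)
      then have "(a, b) \<noteq> (i, i + 1)" using asc by (auto simp: inversions_def)
      then show ?thesis
        using 2 mono[of a b] range[of a] range[of b] by (auto simp: inversions_def)
    qed
  qed
  moreover have "(i, i + 1) \<notin> ?\<phi> ` inversions n w"
  proof
    assume "(i, i + 1) \<in> ?\<phi> ` inversions n w"
    then obtain a b where "(a, b) \<in> inversions n w" "?s a = i" "?s b = i + 1" by auto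
    then have "a = i + 1" "b = i" "a < b"
      by (auto simp: inversions_def simple_reflection_apply split: if_splits)
    then show False by simp
  qed
  moreover have "inj ?\<phi>"
    using injD[OF inj_simple_reflection[of i]] by (auto intro!: injI)
  ultimately show ?thesis
    by (simp add: card_image[OF inj_on_subset[OF \<open>inj ?\<phi>\<close>]])
qed

lemma comp_simple_reflection_twice [simp]:
  "w \<circ> simple_reflection i \<circ> simple_reflection i = w"
  by (auto simp: fun_eq_iff)

lemma card_inversions_descent:
  assumes "1 \<le> i" "i < n" "w (i + 1) < w i"
  shows "card (inversions n w) = Suc (card (inversions n (w \<circ> simple_reflection i)))"
  using card_inversions_ascent[of i n "w \<circ> simple_reflection i"] assms
  by (simp add: simple_reflection_apply)

lemma permutes_comp_simple_reflection:
  assumes "w permutes {1..n}" "1 \<le> i" "i < n"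
  shows "(w \<circ> simple_reflection i) permutes {1..n}"
  using assms by (intro permutes_compose simple_reflection_permutes) auto

lemma permutes_Suc_neq:
  fixes w :: "nat \<Rightarrow> nat"
  assumes "w permutes {1..n}"
  shows "w i \<noteq> w (i + 1)"
  using injD[OF permutes_inj[OF assms], of i "i + 1"] by auto

text \<open>Steps of at least 1 from \<open>f 1\<close> to \<open>f n\<close> leave no slack.
  Applied to \<open>w\<close> it recognises the identity, and applied to \<open>n + 1 - w i\<close>
  the longest element.\<close>

lemma strictly_increasing_eq_self:
  fixes f :: "nat \<Rightarrow> nat"
  assumes step: "\<And>i. 1 \<le> i \<Longrightarrow> i < n \<Longrightarrow> f i < f (i + 1)"
    and range: "\<And>i. i \<in> {1..n} \<Longrightarrow> f i \<in> {1..n}" and i: "i \<in> {1..n}"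
  shows "f i = i"
proof -
  have gap: "f i + k \<le> f (i + k)" if "1 \<le> i" "i + k \<le> n" for i k
    using that
  proof (induction k)
    case (Suc k)
    then show ?case using step[of "i + k"] by simp
  qed simp
  have "f 1 + (i - 1) \<le> f i" "f i + (n - i) \<le> f n" "1 \<le> f 1" "f n \<le> n" "1 \<le> i" "i \<le> n"
    using gap[of 1 "i - 1"] gap[of i "n - i"] range[of 1] range[of n] i by auto
  then show ?thesis by linarith
qed

lemma permutes_no_descent_eq_id:
  fixes w :: "nat \<Rightarrow> nat"
  assumes w: "w permutes {1..n}" and asc: "\<And>i. 1 \<le> i \<Longrightarrow> i < n \<Longrightarrow> w i < w (i + 1)"
  shows "w = id"
proof
  fix i
  show "w i = id i"
    using strictly_increasing_eq_self[of n w i] asc permutes_in_image[OF w] permutes_not_in[OF w, of i]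
    by (cases "i \<in> {1..n}") auto
qed

lemma permutes_no_ascent_eq_longest:
  fixes w :: "nat \<Rightarrow> nat"
  assumes w: "w permutes {1..n}" and desc: "\<And>i. 1 \<le> i \<Longrightarrow> i < n \<Longrightarrow> w (i + 1) < w i"
  shows "w = longest_element n"
proof
  fix i
  have range: "w k \<in> {1..n}" if "k \<in> {1..n}" for k
    using that permutes_in_image[OF w] by blast
  have "n + 1 - w i = i" if "i \<in> {1..n}"
  proof (rule strictly_increasing_eq_self[of n "\<lambda>i. n + 1 - w i"])
    fix k assume "1 \<le> k" "k < n"
    then show "n + 1 - w k < n + 1 - w (k + 1)"
      using desc[of k] range[of k] by auto
  next
    fix k assume "k \<in> {1..n}"
    then show "n + 1 - w k \<in> {1..n}" using range[of k] by auto
  qed (use that in auto)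
  then show "w i = longest_element n i"
    using range[of i] permutes_not_in[OF w, of i] by (auto simp: longest_element_def)
qed

lemma longest_element_permutes: "longest_element n permutes {1..n}"
proof (rule bij_imp_permutes)
  show "bij_betw (longest_element n) {1..n} {1..n}"
    by (rule bij_betw_byWitness[where f' = "longest_element n"]) (auto simp: longest_element_def)
qed (auto simp: longest_element_def)

lemma longest_element_descent:
  "1 \<le> i \<Longrightarrow> i < n \<Longrightarrow> longest_element n (i + 1) < longest_element n i"
  by (auto simp: longest_element_def)

lemma sum_diff_nat_choose: "(\<Sum>i = 1..n. n - i) = n choose 2"
proof (induction n)
  case (Suc n)
  have "(\<Sum>i = 1..Suc n. Suc n - i) = (\<Sum>i = 1..n. n - i + 1)"
    by (simp add: Suc_diff_le)
  also have "\<dots> = (\<Sum>i = 1..n. n - i) + n" by (subst sum.distrib) simp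
  finally show ?case using Suc by (simp add: numeral_2_eq_2)
qed (simp add: numeral_2_eq_2)

lemma card_inversions_longest: "card (inversions n (longest_element n)) = n choose 2"
proof -
  have "inversions n (longest_element n) = (SIGMA a : {1..n}. {a<..n})"
    by (auto simp: inversions_def longest_element_def)
  then show ?thesis by (simp add: sum_diff_nat_choose[simplified])
qed

section \<open>Schubert polynomials\<close>

definition staircase :: "nat \<Rightarrow> (nat \<Rightarrow>\<^sub>0 nat)" where
  "staircase n = (\<Sum>i = 1..n. Poly_Mapping.single i (n - i))"

lemma lookup_staircase: "lookup (staircase n) k = (if k \<in> {1..n} then n - k else 0)"
  by (simp add: staircase_def lookup_sum lookup_single when_def)

text \<open>A relation, because the result might depend on the descents chosen on the way down from
  the longest element; \<open>schubert_ex1\<close> shows that it does not.\<close>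

inductive schubert :: "nat \<Rightarrow> (nat \<Rightarrow> nat) \<Rightarrow> mpoly \<Rightarrow> bool" for n where
  longest: "schubert n (longest_element n) (frag_of (staircase n))"
| step: "schubert n (w \<circ> simple_reflection i) (div_diff i f)"
    if "schubert n w f" "1 \<le> i" "i < n" "w (i + 1) < w i"

lemma schubert_permutes: "schubert n w f \<Longrightarrow> w permutes {1..n}"
  by (induction rule: schubert.induct)
    (simp_all only: longest_element_permutes permutes_comp_simple_reflection)

lemma schubert_from_ascent:
  assumes "schubert n (w \<circ> simple_reflection i) f" "1 \<le> i" "i < n" "w i < w (i + 1)"
  shows "schubert n w (div_diff i f)"
  using schubert.step[OF assms(1-3)] assms(4) by (simp add: simple_reflection_apply)

lemma schubert_cases_ascent:
  assumes "schubert n w f"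
  obtains "w = longest_element n" "f = frag_of (staircase n)"
  | i g where "1 \<le> i" "i < n" "w i < w (i + 1)" "schubert n (w \<circ> simple_reflection i) g" "f = div_diff i g"
  using assms
proof cases
  case (step v g i)
  have "w \<circ> simple_reflection i = v" "w i < w (i + 1)"
    using step(1,6) by (auto simp: simple_reflection_apply)
  then show ?thesis
    using that(2)[of i g] step(2-5) by (simp only:)
qed (use that in blast)

text \<open>Local confluence: two ascents of \<open>w\<close> are joined by a commutation or a braid move.\<close>

lemma schubert_ex1: "w permutes {1..n} \<Longrightarrow> \<exists>!f. schubert n w f"
\<comment> \<open>The induction goes down from the longest element, so the hypothesis covers all
  permutations with more inversions; \<open>n * n\<close> is merely an upper bound.\<close>
proof (induction "n * n - card (inversions n w)" arbitrary: w rule: less_induct)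
  case less
  let ?s = simple_reflection
  have IH: "\<exists>!f. schubert n v f"
    if "card (inversions n w) < card (inversions n v)" "v permutes {1..n}" for v
    using that less.hyps[of v] card_inversions_le[of n v] by simp
  have up: "card (inversions n (v \<circ> ?s i)) = Suc (card (inversions n v)) \<and> (v \<circ> ?s i) permutes {1..n}"
    if "1 \<le> i" "i < n" "v i < v (i + 1)" "v permutes {1..n}" for v i
    using that card_inversions_ascent permutes_comp_simple_reflection by blast
  have confl: "div_diff i f = div_diff j g"
    if i: "1 \<le> i" "i < n" "w i < w (i + 1)" and j: "1 \<le> j" "j < n" "w j < w (j + 1)"
      and f: "schubert n (w \<circ> ?s i) f" and g: "schubert n (w \<circ> ?s j) g" and le: "i \<le> j" for i j f g
  proof -
    have upi: "card (inversions n (w \<circ> ?s i)) = Suc (card (inversions n w))" "(w \<circ> ?s i) permutes {1..n}"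
      using up[OF i less.prems] by auto
    have upj: "card (inversions n (w \<circ> ?s j)) = Suc (card (inversions n w))" "(w \<circ> ?s j) permutes {1..n}"
      using up[OF j less.prems] by auto
    \<comment> \<open>Uniqueness one level up allows \<open>f\<close> and \<open>g\<close> to be
      recomputed from a single polynomial \<open>h\<close> of a permutation above both.\<close>
    have uniq_f: "f' = f" if "schubert n (w \<circ> ?s i) f'" for f'
      using IH[of "w \<circ> ?s i"] upi f that by auto
    have uniq_g: "g' = g" if "schubert n (w \<circ> ?s j) g'" for g'
      using IH[of "w \<circ> ?s j"] upj g that by auto
    consider "i = j" | "i + 1 < j" | "j = i + 1" using le by linarith
    then show ?thesis
    proof cases
      case 1
      then show ?thesis using uniq_f[of g] g by simp
    next
      case 2
      let ?t = "w \<circ> ?s i \<circ> ?s j"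
      have t: "?t = w \<circ> ?s j \<circ> ?s i"
        using 2 by (auto simp: fun_eq_iff simple_reflection_apply)
      have aj: "(w \<circ> ?s i) j < (w \<circ> ?s i) (j + 1)" and ai: "(w \<circ> ?s j) i < (w \<circ> ?s j) (i + 1)"
        using 2 i j by (auto simp: simple_reflection_apply)
      have "card (inversions n w) < card (inversions n ?t)" "?t permutes {1..n}"
        using up[OF j(1,2) aj upi(2)] upi by auto
      then obtain h where h: "schubert n ?t h" using IH by blast
      have "f = div_diff j h"
        using uniq_f[OF schubert_from_ascent[OF h j(1,2) aj]] by simp
      moreover have "g = div_diff i h"
        using uniq_g[OF schubert_from_ascent[OF h[unfolded t] i(1,2) ai]] by simp
      ultimately show ?thesis using div_diff_commute[OF 2] by simp
    next
      case 3
      let ?t1 = "w \<circ> ?s i \<circ> ?s j" and ?t2 = "w \<circ> ?s j \<circ> ?s i"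
      let ?t = "?t1 \<circ> ?s i"
      have t: "?t = ?t2 \<circ> ?s j"
        using 3 by (auto simp: fun_eq_iff simple_reflection_apply)
      have aj: "(w \<circ> ?s i) j < (w \<circ> ?s i) (j + 1)" and ai: "(w \<circ> ?s j) i < (w \<circ> ?s j) (i + 1)"
        and ai': "?t1 i < ?t1 (i + 1)" and aj': "?t2 j < ?t2 (j + 1)"
        using 3 i j by (auto simp: simple_reflection_apply)
      have t1: "card (inversions n ?t1) = Suc (Suc (card (inversions n w)))" "?t1 permutes {1..n}"
        using up[OF j(1,2) aj upi(2)] upi by auto
      have "card (inversions n w) < card (inversions n ?t)" "?t permutes {1..n}"
        using up[OF i(1,2) ai' t1(2)] t1 by auto
      then obtain h where h: "schubert n ?t h" using IH by blast
      have "f = div_diff j (div_diff i h)"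
        by (rule uniq_f[symmetric]) (intro schubert_from_ascent i j ai' aj h)
      moreover have "g = div_diff i (div_diff j h)"
        by (rule uniq_g[symmetric]) (intro schubert_from_ascent i j ai aj' h[unfolded t])
      ultimately show ?thesis
        using div_diff_braid[of i h] 3 by simp
    qed
  qed
  show ?case
  proof (cases "w = longest_element n")
    case True
    show ?thesis
    proof
      show "schubert n w (frag_of (staircase n))" using True schubert.longest by simp
      fix f assume "schubert n w f"
      then show "f = frag_of (staircase n)"
        by (cases rule: schubert_cases_ascent)
          (use True longest_element_descent less_asym in \<open>blast+\<close>)
    qed
  next
    case False
    then obtain i where i: "1 \<le> i" "i < n" "\<not> w (i + 1) < w i"
      using permutes_no_ascent_eq_longest[OF less.prems] by blast
    then have asc: "w i < w (i + 1)"
      using permutes_Suc_neq[OF less.prems, of i] by linarith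
    then obtain f where f: "schubert n (w \<circ> ?s i) f"
      using IH[of "w \<circ> ?s i"] up[OF i(1,2) asc less.prems] by auto
    show ?thesis
    proof
      show "schubert n w (div_diff i f)"
        by (rule schubert_from_ascent[OF f i(1,2) asc])
      fix g assume "schubert n w g"
      then show "g = div_diff i f"
      proof (cases rule: schubert_cases_ascent)
        case (2 j h)
        then show ?thesis
          using confl[of i j f h] confl[of j i h f] i asc f by (metis le_cases)
      qed (use False in simp)
    qed
  qed
qed

text \<open>At an ascent \<open>f\<close> is itself \<open>div_diff i\<close> of the polynomial one
  level up, and \<open>div_diff i\<close> squares to 0.\<close>

lemma schubert_ascent_div_diff:
  assumes f: "schubert n w f" and i: "1 \<le> i" "i < n" "w i < w (i + 1)"
  shows "div_diff i f = 0"
proof -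
  have w: "w permutes {1..n}" using f by (rule schubert_permutes)
  then obtain g where g: "schubert n (w \<circ> simple_reflection i) g"
    using schubert_ex1[OF permutes_comp_simple_reflection] i by blast
  have "f = div_diff i g"
    using schubert_ex1[OF w] f schubert_from_ascent[OF g i] by blast
  then show ?thesis by simp
qed

lemma keys_div_diff_mono:
  assumes "m' \<in> Poly_Mapping.keys (div_diff_mono i m)"
  obtains c where "m' = set_exps i m c (lookup m i + lookup m (i + 1) - 1 - c)"
    "min (lookup m i) (lookup m (i + 1)) \<le> c" "c < max (lookup m i) (lookup m (i + 1))"
proof -
  have "\<exists>c. m' = set_exps i m c (lookup m i + lookup m (i + 1) - 1 - c) \<and>
    min (lookup m i) (lookup m (i + 1)) \<le> c \<and> c < max (lookup m i) (lookup m (i + 1))"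
    using assms by (auto simp: div_diff_mono_def Let_def min_def max_def split: if_splits
        dest!: subsetD[OF keys_sum])
  then show ?thesis using that by blast
qed

lemma sum_set_exps:
  assumes i: "1 \<le> i" "i < n" and cd: "Suc (c + d) = lookup m i + lookup m (i + 1)"
  shows "Suc (\<Sum>k = 1..n. lookup (set_exps i m c d) k) = (\<Sum>k = 1..n. lookup m k)"
proof -
  have split: "(\<Sum>k = 1..n. g k) = g i + g (i + 1) + (\<Sum>k \<in> {1..n} - {i, i + 1}. g k)" for g :: "nat \<Rightarrow> nat"
  proof -
    have "{1..n} = insert i (insert (i + 1) ({1..n} - {i, i + 1}))" using i by auto
    then have "sum g {1..n} = sum g (insert i (insert (i + 1) ({1..n} - {i, i + 1})))" by simp
    then show ?thesis by simp
  qed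
  have "(\<Sum>k \<in> {1..n} - {i, i + 1}. lookup (set_exps i m c d) k) = (\<Sum>k \<in> {1..n} - {i, i + 1}. lookup m k)"
    by (intro sum.cong) auto
  then show ?thesis
    unfolding split[of "lookup m"] split[of "lookup (set_exps i m c d)"] using cd by simp
qed

text \<open>These are the two conditions of \<open>sum_poly_weight_div_diff\<close>: the degree is
  the length, and the bound at \<open>k = n\<close> says that x_n does not occur.\<close>

lemma schubert_keys:
  assumes "schubert n w f" "m \<in> Poly_Mapping.keys f"
  shows "(\<Sum>k = 1..n. lookup m k) = card (inversions n w) \<and> (\<forall>k \<in> {1..n}. lookup m k \<le> n - k)"
  using assms
proof (induction arbitrary: m rule: schubert.induct)
  case longest
  then show ?case
    by (simp add: card_inversions_longest lookup_staircase sum_diff_nat_choose[simplified])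
next
  case (step w f i)
  then obtain m0 where m0: "m0 \<in> Poly_Mapping.keys f" "m \<in> Poly_Mapping.keys (div_diff_mono i m0)"
    unfolding div_diff_def using keys_frag_extend by fastforce
  obtain c where c: "m = set_exps i m0 c (lookup m0 i + lookup m0 (i + 1) - 1 - c)"
    "min (lookup m0 i) (lookup m0 (i + 1)) \<le> c" "c < max (lookup m0 i) (lookup m0 (i + 1))"
    using keys_div_diff_mono[OF m0(2)] by blast
  have "c + 1 \<le> lookup m0 i + lookup m0 (i + 1)" using c by linarith
  then have deg: "Suc (\<Sum>k = 1..n. lookup m k) = (\<Sum>k = 1..n. lookup m0 k)"
    unfolding c(1) using step.hyps by (intro sum_set_exps) auto
  have box: "lookup m0 k \<le> n - k" if "k \<in> {1..n}" for k
    using step.IH[OF m0(1)] that by blast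
  \<comment> \<open>Both new exponents are less than the larger of the old ones, which is at most
    \<open>n - i\<close>; hence even the one at \<open>i + 1\<close> respects its bound.\<close>
  have "lookup m k \<le> n - k" if "k \<in> {1..n}" for k
    using box[of i] box[of "i + 1"] box[OF that] c step.hyps by (auto simp: min_def max_def split: if_splits)
  then show ?case
    using deg step.IH[OF m0(1)] card_inversions_descent[of i n w] step.hyps by (simp add: comp_def)
qed

section \<open>Words counted by their last letter\<close>

lemma word_product_simps [simp]:
  "word_product [] = id"
  "word_product (i # u) = simple_reflection i \<circ> word_product u"
  by (simp_all add: word_product_def)

lemma word_product_append [simp]: "word_product (u @ v) = word_product u \<circ> word_product v"
  by (induction u) (simp_all add: comp_assoc)

lemma word_product_permutes: "set u \<subseteq> {1..n - 1} \<Longrightarrow> word_product u permutes {1..n}"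
proof (induction u)
  case (Cons i u)
  then have "simple_reflection i permutes {1..n}"
    by (intro simple_reflection_permutes) auto
  then show ?case using Cons permutes_compose[of "word_product u" "{1..n}" "simple_reflection i"] by (simp add: comp_def)
qed (simp add: permutes_id)

lemma card_inversions_word_product_le:
  "set u \<subseteq> {1..n - 1} \<Longrightarrow> card (inversions n (word_product u)) \<le> length u"
proof (induction u rule: rev_induct)
  case (snoc i u)
  let ?w = "word_product u"
  have i: "1 \<le> i" "i < n" using snoc.prems by auto
  have "?w i \<noteq> ?w (i + 1)"
    by (rule permutes_Suc_neq[OF word_product_permutes]) (use snoc.prems in auto)
  then have "card (inversions n (?w \<circ> simple_reflection i)) \<le> Suc (card (inversions n ?w))"
    using card_inversions_ascent[OF i, of ?w] card_inversions_descent[OF i, of ?w] by linarith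
  then show ?case using snoc by (simp add: comp_def)
next
  case Nil
  have "inversions n id = {}" by (auto simp: inversions_def)
  then show ?case by (simp add: id_def)
qed

text \<open>Prescribing the length instead of demanding minimality gives a last-letter recursion
  without side conditions.\<close>

definition words_of_length :: "nat \<Rightarrow> nat \<Rightarrow> (nat \<Rightarrow> nat) \<Rightarrow> nat list set" where
  "words_of_length n l w = {u \<in> words_for n w. length u = l}"

lemma finite_words_of_length [simp]: "finite (words_of_length n l w)"
  by (rule finite_subset[OF _ finite_lists_length_eq[of "{1..n - 1}" l]])
    (auto simp: words_of_length_def words_for_def)

lemma words_of_length_empty: "l < card (inversions n w) \<Longrightarrow> words_of_length n l w = {}"
  using card_inversions_word_product_le by (fastforce simp: words_of_length_def words_for_def)

lemma snoc_in_words_of_length: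
  "u @ [i] \<in> words_of_length n (Suc l) w \<longleftrightarrow>
   i \<in> {1..n - 1} \<and> u \<in> words_of_length n l (w \<circ> simple_reflection i)"
proof -
  have "word_product u \<circ> simple_reflection i = w \<longleftrightarrow> word_product u = w \<circ> simple_reflection i"
    by (metis comp_simple_reflection_twice)
  then show ?thesis by (auto simp: words_of_length_def words_for_def)
qed

lemma words_of_length_Suc:
  "words_of_length n (Suc l) w =
   (\<Union>i \<in> {1..n - 1}. (\<lambda>u. u @ [i]) ` words_of_length n l (w \<circ> simple_reflection i))"
proof (intro equalityI subsetI)
  fix u assume u: "u \<in> words_of_length n (Suc l) w"
  then have "u \<noteq> []" by (auto simp: words_of_length_def)
  then obtain v i where "u = v @ [i]" by (metis rev_exhaust)
  with u show "u \<in> (\<Union>i \<in> {1..n - 1}. (\<lambda>u. u @ [i]) ` words_of_length n l (w \<circ> simple_reflection i))"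
    by (auto simp: snoc_in_words_of_length)
next
  fix u assume "u \<in> (\<Union>i \<in> {1..n - 1}. (\<lambda>u. u @ [i]) ` words_of_length n l (w \<circ> simple_reflection i))"
  then show "u \<in> words_of_length n (Suc l) w"
    by (auto simp: snoc_in_words_of_length)
qed

lemma card_words_of_length_Suc:
  "card (words_of_length n (Suc l) w) = (\<Sum>i = 1..n - 1. card (words_of_length n l (w \<circ> simple_reflection i)))"
  unfolding words_of_length_Suc
  by (subst card_UN_disjoint) (auto simp: card_image inj_on_def)

text \<open>Both sides obey the same recursion over the last letter. A letter at an ascent
  contributes no words on the left and a vanishing divided difference on the right. The normalising
  constant \<open>poly_weight n e\<close> is carried along unevaluated.\<close>

lemma card_words_poly_weight:
  assumes n: "1 \<le> n" and one: "schubert n id e"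
  shows "schubert n w f \<Longrightarrow> card (inversions n w) = l \<Longrightarrow>
    real (card (words_of_length n l w)) * poly_weight n e = fact l * poly_weight n f"
proof (induction l arbitrary: w f)
  case 0
  have w: "w permutes {1..n}" using 0(1) by (rule schubert_permutes)
  have "w = id"
  proof (rule permutes_no_descent_eq_id[OF w])
    fix i assume "1 \<le> i" "i < n"
    then show "w i < w (i + 1)"
      using 0 permutes_Suc_neq[OF w, of i] card_inversions_descent[of i n w] by (metis nat.distinct(1) linorder_neqE_nat)
  qed
  moreover from this have "f = e"
    using schubert_ex1[of id n] permutes_id one 0 by blast
  moreover have "words_of_length n 0 id = {[]}"
    by (auto simp: words_of_length_def words_for_def)
  ultimately show ?case by (simp add: id_def)
next
  case (Suc l)
  have w: "w permutes {1..n}" using Suc.prems(1) by (rule schubert_permutes)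
  have *: "real (card (words_of_length n l (w \<circ> simple_reflection i))) * poly_weight n e =
      fact l * poly_weight n (div_diff i f)" if "i \<in> {1..n - 1}" for i
  proof -
    have i: "1 \<le> i" "i < n" using that by auto
    show ?thesis
    proof (cases "w (i + 1) < w i")
      case True
      then have "card (inversions n (w \<circ> simple_reflection i)) = l"
        using card_inversions_descent[of i n w] i Suc.prems by simp
      then show ?thesis
        using Suc.IH schubert.step[OF Suc.prems(1) i True] by blast
    next
      case False
      then have asc: "w i < w (i + 1)" using permutes_Suc_neq[OF w, of i] by linarith
      then have "words_of_length n l (w \<circ> simple_reflection i) = {}"
        using card_inversions_ascent[OF i asc] Suc.prems by (intro words_of_length_empty) simp
      then show ?thesis
        using schubert_ascent_div_diff[OF Suc.prems(1) i asc] by simp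
    qed
  qed
  \<comment> \<open>The degree \<open>Suc l\<close> is the factor that turns \<open>fact l\<close>
    into \<open>fact (Suc l)\<close>.\<close>
  have "(\<Sum>i = 1..n - 1. poly_weight n (div_diff i f)) = real (Suc l) * poly_weight n f"
    using schubert_keys[OF Suc.prems(1)] Suc.prems(2) n by (intro sum_poly_weight_div_diff) force+
  then show ?case
    using * by (simp add: card_words_of_length_Suc sum_distrib_right flip: sum_distrib_left)
qed

section \<open>The longest element\<close>

text \<open>Every word has at least as many letters as its product has inversions. That this bound
  is attained is a hypothesis here; the nonzero count in the final theorem supplies it.\<close>

lemma reduced_words_longest:
  assumes "words_of_length n (n choose 2) (longest_element n) \<noteq> {}"
  shows "reduced_words n (longest_element n) = words_of_length n (n choose 2) (longest_element n)"
proof -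
  have "perm_length n (longest_element n) = n choose 2"
    unfolding perm_length_def
  proof (rule Least_equality)
    show "\<exists>u \<in> words_for n (longest_element n). length u = n choose 2"
      using assms by (auto simp: words_of_length_def)
  next
    fix m assume "\<exists>u \<in> words_for n (longest_element n). length u = m"
    then obtain u where "set u \<subseteq> {1..n - 1}" "word_product u = longest_element n" "length u = m"
      by (auto simp: words_for_def)
    then show "n choose 2 \<le> m"
      using card_inversions_word_product_le[of u n] card_inversions_longest[of n] by simp
  qed
  then show ?thesis by (simp add: reduced_words_def words_of_length_def)
qed

section \<open>Rotation of words for the longest element\<close>

definition rotate_word :: "nat \<Rightarrow> nat list \<Rightarrow> nat list" where
  "rotate_word n u = (n - last u) # butlast u"

text \<open>Conjugation by the longest element exchanges the reflections at \<open>i\<close> and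
  \<open>n - i\<close>; this is why the rotated letter is replaced by its complement.\<close>

lemma simple_reflection_longest:
  assumes "1 \<le> i" "i < n"
  shows "simple_reflection (n - i) \<circ> longest_element n \<circ> simple_reflection i = longest_element n"
proof
  fix k
  consider "k = i" | "k = i + 1" | "k \<noteq> i" "k \<noteq> i + 1" "k \<in> {1..n}" | "k \<notin> {1..n}" by blast
  then show "(simple_reflection (n - i) \<circ> longest_element n \<circ> simple_reflection i) k = longest_element n k"
  proof cases
    case 3
    then have "n + 1 - k \<noteq> n - i" "n + 1 - k \<noteq> n - i + 1" "n + 1 - k \<in> {1..n}" using assms by auto
    then show ?thesis using 3 by (simp add: simple_reflection_apply longest_element_def)
  next
    case 4
    then have "k \<noteq> i" "k \<noteq> i + 1" "k \<noteq> n - i" "k \<noteq> n - i + 1" using assms by auto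
    then show ?thesis using 4 by (auto simp: simple_reflection_apply longest_element_def)
  qed (use assms in \<open>simp_all add: simple_reflection_apply longest_element_def\<close>)
qed

lemma rotate_word_in_words:
  assumes "u \<in> words_of_length n l (longest_element n)" "0 < l"
  shows "rotate_word n u \<in> words_of_length n l (longest_element n)"
proof -
  obtain m where m: "l = Suc m" using assms by (cases l) auto
  then have "u \<noteq> []" using assms by (auto simp: words_of_length_def)
  then obtain v i where u: "u = v @ [i]" by (metis rev_exhaust)
  then have i: "1 \<le> i" "i < n" and v: "v \<in> words_of_length n m (longest_element n \<circ> simple_reflection i)"
    using assms by (auto simp: m snoc_in_words_of_length)
  then show ?thesis
    using simple_reflection_longest[OF i]
    by (auto simp: u m rotate_word_def words_of_length_def words_for_def comp_assoc)
qed

lemma rotate_word_bij: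
  assumes "0 < l"
  shows "bij_betw (rotate_word n) (words_of_length n l (longest_element n)) (words_of_length n l (longest_element n))"
proof -
  let ?W = "words_of_length n l (longest_element n)"
  have inj: "inj_on (rotate_word n) ?W"
  proof (rule inj_onI)
    fix u v assume uv: "u \<in> ?W" "v \<in> ?W" "rotate_word n u = rotate_word n v"
    have ne: "u \<noteq> []" "v \<noteq> []" using uv assms by (auto simp: words_of_length_def)
    then have "last u \<in> {1..n - 1}" "last v \<in> {1..n - 1}"
      using uv(1,2) last_in_set by (fastforce simp: words_of_length_def words_for_def)+
    then have "last u = last v" "butlast u = butlast v"
      using uv(3) by (auto simp: rotate_word_def)
    then show "u = v" using ne by (metis append_butlast_last_id)
  qed
  moreover have "rotate_word n ` ?W = ?W"
    using rotate_word_in_words assms by (intro endo_inj_surj inj) auto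
  ultimately show ?thesis by (simp add: bij_betw_def)
qed

lemma supports_commutation_rotate_word:
  assumes "1 \<le> k" "k + 1 < length u"
  shows "supports_commutation (rotate_word n u) (k + 1) \<longleftrightarrow> supports_commutation u k"
  using assms by (cases k) (simp_all add: supports_commutation_def rotate_word_def nth_butlast)

text \<open>Rotation by one letter makes every position behave like the last one.\<close>

lemma card_not_supports_commutation:
  assumes "1 \<le> k" "k \<le> l - 1"
  shows "card {u \<in> words_of_length n l (longest_element n). \<not> supports_commutation u k} =
    card {u \<in> words_of_length n l (longest_element n). \<not> supports_commutation u (l - 1)}"
  using assms(2,1)
proof (induction k rule: inc_induct)
  case (step k)
  let ?W = "words_of_length n l (longest_element n)"
  have bij: "bij_betw (rotate_word n) ?W ?W"
    using step by (intro rotate_word_bij) simp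
  have supp: "supports_commutation (rotate_word n u) (Suc k) = supports_commutation u k" if "u \<in> ?W" for u
    using that step supports_commutation_rotate_word[of k u n] by (simp add: words_of_length_def)
  have "{u \<in> ?W. \<not> supports_commutation u (Suc k)} = rotate_word n ` {u \<in> ?W. \<not> supports_commutation u k}"
  proof -
    have "{u \<in> ?W. \<not> supports_commutation u (Suc k)} =
        {u \<in> rotate_word n ` ?W. \<not> supports_commutation u (Suc k)}"
      using bij by (simp add: bij_betw_def)
    also have "\<dots> = rotate_word n ` {u \<in> ?W. \<not> supports_commutation u k}"
      using supp by blast
    finally show ?thesis .
  qed
  moreover have "inj_on (rotate_word n) {u \<in> ?W. \<not> supports_commutation u k}"
    using bij by (auto simp: bij_betw_def intro: inj_on_subset)
  ultimately show ?case
    using step by (simp add: card_image)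
qed simp

text \<open>Letters that do not commute under the definition are equal or neighbours. Equal ones
  cancel and would leave a word for \<open>w\<close> with fewer letters than \<open>w\<close> has
  inversions.\<close>

lemma card_not_supports_commutation_last:
  assumes l: "l = Suc (Suc m)" "l = card (inversions n w)"
  shows "card {u \<in> words_of_length n l w. \<not> supports_commutation u (l - 1)} =
    (\<Sum>j = 1..n - 2. card (words_of_length n m (w \<circ> simple_reflection j \<circ> simple_reflection (j + 1)))
      + card (words_of_length n m (w \<circ> simple_reflection (j + 1) \<circ> simple_reflection j)))"
proof -
  \<comment> \<open>In a pair \<open>(j, k)\<close> the last letter is \<open>j\<close> and the one
    before it is \<open>k\<close>.\<close>
  define c where "c = (\<lambda>(j, k). card (words_of_length n m (w \<circ> simple_reflection j \<circ> simple_reflection k)))"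
  define P where "P = {(j, k). j \<in> {1..n - 1} \<and> k \<in> {1..n - 1} \<and> \<not> \<bar>int k - int j\<bar> > 1}"
  define A where "A = (\<lambda>(j, k). (\<lambda>v. v @ [k, j]) ` words_of_length n m (w \<circ> simple_reflection j \<circ> simple_reflection k))"
  have finP: "finite P"
    by (rule finite_subset[of _ "{1..n - 1} \<times> {1..n - 1}"]) (auto simp: P_def)
  have mem: "v @ [k, j] \<in> words_of_length n l w \<longleftrightarrow> j \<in> {1..n - 1} \<and> k \<in> {1..n - 1} \<and>
      v \<in> words_of_length n m (w \<circ> simple_reflection j \<circ> simple_reflection k)" for v k j
    using snoc_in_words_of_length[of "v @ [k]" j n "Suc m" w] snoc_in_words_of_length[of v k n m]
    by (auto simp: l(1))
  have supp: "supports_commutation (v @ [k, j]) (l - 1) \<longleftrightarrow> \<bar>int k - int j\<bar> > 1"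
    if "length v = m" for v k j
    using that by (simp add: supports_commutation_def l(1) nth_append)
  have "{u \<in> words_of_length n l w. \<not> supports_commutation u (l - 1)} = (\<Union>p \<in> P. A p)"
  proof (intro equalityI subsetI)
    fix u assume u: "u \<in> {u \<in> words_of_length n l w. \<not> supports_commutation u (l - 1)}"
    then have len: "length u = Suc (Suc m)" by (simp add: words_of_length_def l(1))
    then obtain v j where v: "u = v @ [j]" "length v = Suc m" by (metis length_Suc_conv_rev)
    then obtain v' k where v': "v = v' @ [k]" "length v' = m" by (metis length_Suc_conv_rev)
    then have "(j, k) \<in> P" "u \<in> A (j, k)"
      using u v mem[of v' k j] supp[of v' k j] by (auto simp: P_def A_def)
    then show "u \<in> (\<Union>p \<in> P. A p)" by blast
  next
    fix u assume "u \<in> (\<Union>p \<in> P. A p)"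
    then obtain j k v where "(j, k) \<in> P" "u = v @ [k, j]"
      "v \<in> words_of_length n m (w \<circ> simple_reflection j \<circ> simple_reflection k)"
      by (auto simp: A_def)
    then show "u \<in> {u \<in> words_of_length n l w. \<not> supports_commutation u (l - 1)}"
      using mem[of v k j] supp[of v k j] by (auto simp: P_def words_of_length_def)
  qed
  moreover have "card (\<Union>p \<in> P. A p) = (\<Sum>p \<in> P. card (A p))"
    using finP by (intro card_UN_disjoint) (auto simp: A_def)
  moreover have "card (A p) = c p" for p
    by (cases p) (simp add: A_def c_def card_image inj_on_def)
  ultimately have "card {u \<in> words_of_length n l w. \<not> supports_commutation u (l - 1)} = (\<Sum>p \<in> P. c p)"
    by simp
  also have "\<dots> = (\<Sum>p \<in> (\<lambda>j. (j, j + 1)) ` {1..n - 2} \<union> (\<lambda>j. (j + 1, j)) ` {1..n - 2}. c p)"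
  proof (rule sum.mono_neutral_right[OF finP])
    show "(\<lambda>j. (j, j + 1)) ` {1..n - 2} \<union> (\<lambda>j. (j + 1, j)) ` {1..n - 2} \<subseteq> P"
      by (auto simp: P_def)
    show "\<forall>p \<in> P - ((\<lambda>j. (j, j + 1)) ` {1..n - 2} \<union> (\<lambda>j. (j + 1, j)) ` {1..n - 2}). c p = 0"
    proof
      fix p assume p: "p \<in> P - ((\<lambda>j. (j, j + 1)) ` {1..n - 2} \<union> (\<lambda>j. (j + 1, j)) ` {1..n - 2})"
      obtain j k where jk: "p = (j, k)" by fastforce
      have "\<not> (k = j + 1 \<and> j \<in> {1..n - 2})" "\<not> (j = k + 1 \<and> k \<in> {1..n - 2})"
        using p unfolding jk by blast+
      moreover have "j \<in> {1..n - 1}" "k \<in> {1..n - 1}" "k \<le> j + 1" "j \<le> k + 1"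
        using p unfolding jk P_def by auto
      ultimately have "j = k" by auto
      then have "c p = card (words_of_length n m w)" by (simp add: c_def jk)
      also have "words_of_length n m w = {}"
        using l by (intro words_of_length_empty) simp
      finally show "c p = 0" by simp
    qed
  qed
  also have "\<dots> = (\<Sum>p \<in> (\<lambda>j. (j, j + 1)) ` {1..n - 2}. c p) + (\<Sum>p \<in> (\<lambda>j. (j + 1, j)) ` {1..n - 2}. c p)"
    by (rule sum.union_disjoint) auto
  finally show ?thesis
    by (simp add: sum.reindex inj_on_def c_def sum.distrib)
qed

section \<open>Weights at the staircase monomial\<close>

lemma poly_weight_staircase:
  "poly_weight n (frag_of (staircase n)) = frobenius_weight n (\<lambda>i. 2 * (n - i))"
  by (auto simp: shifted_def lookup_staircase intro!: frobenius_weight_cong)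

text \<open>Neighbouring staircase exponents differ by 1, so the inner divided difference is a
  single monomial and the formula for monomials applies to the outer one.\<close>

lemma poly_weight_staircase_lower2:
  assumes j: "1 \<le> j" "j < n" and k: "1 \<le> k" "k < n" and jk: "j \<noteq> k"
  shows "poly_weight n (div_diff k (div_diff j (frag_of (staircase n)))) =
    frobenius_weight n ((\<lambda>i. 2 * (n - i))(j := 2 * (n - j) - 1, k := 2 * (n - k) - 1))"
proof -
  let ?m = "set_exps j (staircase n) (n - (j + 1)) (n - (j + 1))"
  have "{n - (j + 1)..<n - j} = {n - (j + 1)}" using j by auto
  then have "div_diff j (frag_of (staircase n)) = frag_of ?m"
    using j by (simp add: div_diff_mono_def lookup_staircase Let_def)
  then have "poly_weight n (div_diff k (div_diff j (frag_of (staircase n)))) =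
      frobenius_weight n ((shifted n ?m)(k := shifted n ?m k - 1))"
    using k by (simp add: poly_weight_div_diff_mono)
  also have "\<dots> = frobenius_weight n ((\<lambda>i. 2 * (n - i))(j := 2 * (n - j) - 1, k := 2 * (n - k) - 1))"
    using j k jk by (intro frobenius_weight_cong) (auto simp: shifted_def lookup_staircase)
  finally show ?thesis .
qed

lemma inj_on_double_diff: "inj_on (\<lambda>i. real (2 * (n - i))) {1..n}"
  by (auto simp: inj_on_def)

lemma frobenius_weight_nonzero: "frobenius_weight n (\<lambda>i. 2 * (n - i)) \<noteq> 0"
  using vandermonde_nonzero[OF inj_on_double_diff] by (simp add: frobenius_weight_def)

lemma double_fact_Suc_Suc: "double_fact (Suc (Suc m)) = Suc (Suc m) * double_fact m"
proof -
  have "{k \<in> {1..Suc (Suc m)}. even k \<longleftrightarrow> even (Suc (Suc m))} =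
      insert (Suc (Suc m)) {k \<in> {1..m}. even k \<longleftrightarrow> even m}"
    by (auto simp: le_Suc_eq)
  then show ?thesis by (simp add: double_fact_def)
qed

lemma double_fact_1: "double_fact (Suc 0) = 1"
proof -
  have "{k \<in> {1..Suc 0}. even k \<longleftrightarrow> even (Suc 0)} = {1}" by auto
  then show ?thesis by (simp add: double_fact_def)
qed

lemma double_fact_0: "double_fact 0 = 1"
  by (simp add: double_fact_def)

text \<open>The factor \<open>t\<close> belongs to the index at distance \<open>t\<close> below
  \<open>j\<close>. The second odd factors start at 5, so their product is (2p + 3)!!/3: the origin
  of the 3 in the theorem.\<close>

lemma prod_odd_even_up:
  "(\<Prod>t = 1..p. (2 * real t + 1) * (2 * real t + 3) / (2 * real t * (2 * real t + 2))) =
   real (double_fact (2 * p + 1)) * real (double_fact (2 * p + 3)) / (3 * 4 ^ p * fact p * fact (p + 1))"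
proof (induction p)
  case 0
  then show ?case by (simp add: double_fact_1 double_fact_Suc_Suc numeral_3_eq_3)
next
  case (Suc p)
  have "real (double_fact (2 * Suc p + 1)) = (2 * real p + 3) * double_fact (2 * p + 1)"
    "real (double_fact (2 * Suc p + 3)) = (2 * real p + 5) * double_fact (2 * p + 3)"
    using double_fact_Suc_Suc[of "2 * p + 1"] double_fact_Suc_Suc[of "2 * p + 3"]
    by (simp_all add: algebra_simps)
  then have "real (double_fact (2 * Suc p + 1)) * real (double_fact (2 * Suc p + 3)) /
        (3 * 4 ^ Suc p * fact (Suc p) * fact (Suc p + 1)) =
      real (double_fact (2 * p + 1)) * real (double_fact (2 * p + 3)) / (3 * 4 ^ p * fact p * fact (p + 1)) *
      ((2 * real p + 3) * (2 * real p + 5) / (4 * (real p + 1) * (real p + 2)))"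
    by (simp add: mult_ac add_ac)
  moreover have "(2 * real (Suc p) + 1) * (2 * real (Suc p) + 3) / (2 * real (Suc p) * (2 * real (Suc p) + 2)) =
      (2 * real p + 3) * (2 * real p + 5) / (4 * (real p + 1) * (real p + 2))"
    by (simp add: divide_simps) (simp add: algebra_simps)
  ultimately show ?case
    using Suc.IH by simp
qed

text \<open>The corresponding product over the indices at distance \<open>t\<close> above
  \<open>j + 1\<close>.\<close>

lemma prod_odd_even_down:
  "(\<Prod>t = 1..p. (2 * real t + 1) * (2 * real t - 1) / (2 * real t * (2 * real t + 2))) =
   real (double_fact (2 * p + 1)) * real (double_fact (2 * p - 1)) / (4 ^ p * fact p * fact (p + 1))"
proof (induction p)
  case 0
  then show ?case by (simp add: double_fact_1 double_fact_0)
next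
  case (Suc p)
  have "real (double_fact (2 * Suc p + 1)) = (2 * real p + 3) * double_fact (2 * p + 1)"
    using double_fact_Suc_Suc[of "2 * p + 1"] by (simp add: algebra_simps)
  \<comment> \<open>For \<open>p = 0\<close> truncated subtraction gives
    \<open>double_fact 0 = 1\<close> in place of (-1)!!, hence the case split.\<close>
  moreover have "real (double_fact (2 * Suc p - 1)) = (2 * real p + 1) * double_fact (2 * p - 1)"
    using double_fact_Suc_Suc[of "2 * p - 1"] by (cases p) (simp_all add: double_fact_0 double_fact_1 algebra_simps)
  ultimately have "real (double_fact (2 * Suc p + 1)) * real (double_fact (2 * Suc p - 1)) /
        (4 ^ Suc p * fact (Suc p) * fact (Suc p + 1)) =
      real (double_fact (2 * p + 1)) * real (double_fact (2 * p - 1)) / (4 ^ p * fact p * fact (p + 1)) *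
      ((2 * real p + 3) * (2 * real p + 1) / (4 * (real p + 1) * (real p + 2)))"
    by (simp add: mult_ac add_ac)
  moreover have "(2 * real (Suc p) + 1) * (2 * real (Suc p) - 1) / (2 * real (Suc p) * (2 * real (Suc p) + 2)) =
      (2 * real p + 3) * (2 * real p + 1) / (4 * (real p + 1) * (real p + 2))"
    by (simp add: divide_simps) (simp add: algebra_simps)
  ultimately show ?case
    using Suc.IH by simp
qed

text \<open>The entries are lowered one after the other. Their mutual difference goes from 2 to 1
  and back to 2, so only factors with a third index contribute.\<close>

lemma vandermonde_lower_adjacent:
  fixes n j :: nat
  defines "x \<equiv> \<lambda>i. real (2 * (n - i))"
  assumes j: "1 \<le> j" "j + 1 < n"
  shows "vandermonde n (x(j := x j - 1, j + 1 := x (j + 1) - 1)) = vandermonde n x *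
    (\<Prod>i \<in> {1..n} - {j, j + 1}. (x j - 1 - x i) * (x (j + 1) - 1 - x i) / ((x j - x i) * (x (j + 1) - x i)))"
proof -
  define I where "I = {1..n} - {j, j + 1}"
  define x' where "x' = x(j := x j - 1)"
  have I: "{1..n} - {j} = insert (j + 1) I" "{1..n} - {j + 1} = insert j I" "finite I" "j \<notin> I" "j + 1 \<notin> I"
    using j by (auto simp: I_def)
  have xj: "x j = x (j + 1) + 2"
    using j by (simp add: x_def of_nat_diff)
  have inj: "inj_on x {1..n}" unfolding x_def by (rule inj_on_double_diff)
  have ne: "x j - x i \<noteq> 0" "x (j + 1) - x i \<noteq> 0" if "i \<in> I" for i
    using that inj_onD[OF inj, of j i] inj_onD[OF inj, of "j + 1" i] j by (auto simp: I_def)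
  have x': "x' i = x i" if "i \<in> I" for i
    using that by (auto simp: x'_def I_def)
  have P: "(\<Prod>i \<in> I. c - x' i) = (\<Prod>i \<in> I. c - x i)" for c
    by (intro prod.cong) (auto simp: x')
  have 1: "vandermonde n x' * (2 * (\<Prod>i \<in> I. x j - x i)) = vandermonde n x * (\<Prod>i \<in> I. x j - 1 - x i)"
    using vandermonde_fun_upd[of j n x "x j - 1"] j I by (simp add: x'_def xj)
  have "vandermonde n (x'(j + 1 := x (j + 1) - 1)) * ((x (j + 1) - x' j) * (\<Prod>i \<in> I. x (j + 1) - x' i)) =
      vandermonde n x' * ((x (j + 1) - 1 - x' j) * (\<Prod>i \<in> I. x (j + 1) - 1 - x' i))"
    using vandermonde_fun_upd[of "j + 1" n x' "x (j + 1) - 1"] j I by (simp add: x'_def)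
  moreover have "x' j = x (j + 1) + 1" by (simp add: x'_def xj)
  ultimately have 2: "vandermonde n (x'(j + 1 := x (j + 1) - 1)) * (\<Prod>i \<in> I. x (j + 1) - x i) =
      2 * vandermonde n x' * (\<Prod>i \<in> I. x (j + 1) - 1 - x i)"
    unfolding P by simp
  have "(\<Prod>i \<in> I. x j - x i) \<noteq> 0" "(\<Prod>i \<in> I. x (j + 1) - x i) \<noteq> 0"
    using ne I by simp_all
  then have "vandermonde n (x'(j + 1 := x (j + 1) - 1)) = vandermonde n x *
      ((\<Prod>i \<in> I. x j - 1 - x i) * (\<Prod>i \<in> I. x (j + 1) - 1 - x i)) /
      ((\<Prod>i \<in> I. x j - x i) * (\<Prod>i \<in> I. x (j + 1) - x i))"
    using 1 2 by (simp add: eq_divide_eq) algebra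
  then show ?thesis
    unfolding I_def[symmetric] x'_def by (simp add: prod_dividef prod.distrib)
qed

lemma frobenius_weight_lower_adjacent:
  assumes j: "1 \<le> j" "j + 1 < n"
  shows "frobenius_weight n ((\<lambda>i. 2 * (n - i))(j := 2 * (n - j) - 1, j + 1 := 2 * (n - (j + 1)) - 1)) =
    frobenius_weight n (\<lambda>i. 2 * (n - i)) / (3 * 4 ^ (n - 3)) *
    (real (double_fact (2 * j - 1)) / fact (j - 1) * (real (double_fact (2 * j + 1)) / fact j)
     * (real (double_fact (2 * n - 2 * j - 3)) / fact (n - j - 2))
     * (real (double_fact (2 * n - 2 * j - 1)) / fact (n - j - 1)))"
proof -
  define l where "l = (\<lambda>i. 2 * (n - i))"
  define l1 where "l1 = l(j := l j - 1)"
  define l2 where "l2 = l1(j + 1 := l1 (j + 1) - 1)"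
  define x where "x = (\<lambda>i. real (l i))"
  \<comment> \<open>There are \<open>p\<close> indices below \<open>j\<close> and
    \<open>Suc q\<close> above \<open>j + 1\<close>; hence \<open>n - 3 = p + q\<close>.\<close>
  obtain p where p: "j = Suc p" using j by (cases j) auto
  obtain q where q: "n = j + 1 + Suc q" using less_imp_Suc_add[OF j(2)] by auto
  define r where "r i = (x j - 1 - x i) * (x (j + 1) - 1 - x i) / ((x j - x i) * (x (j + 1) - x i))" for i
  have lj: "l j = 2 * q + 4" "l (j + 1) = 2 * q + 2" "l1 (j + 1) = 2 * q + 2"
    by (simp_all add: l_def l1_def q)
  have "(\<Prod>k = 1..n. fact (l k) :: real) = real (l j) * (\<Prod>k = 1..n. fact (l1 k))"
    unfolding l1_def by (rule prod_fact_lower) (use j lj in auto)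
  also have "(\<Prod>k = 1..n. fact (l1 k) :: real) = real (l1 (j + 1)) * (\<Prod>k = 1..n. fact (l2 k))"
    unfolding l2_def by (rule prod_fact_lower) (use j lj in auto)
  finally have fact: "(\<Prod>k = 1..n. fact (l k) :: real) =
      (2 * real q + 4) * (2 * real q + 2) * (\<Prod>k = 1..n. fact (l2 k))"
    unfolding lj by (simp only: of_nat_add of_nat_mult of_nat_numeral mult.assoc)
  have "(\<lambda>i. real (l2 i)) = x(j := x j - 1, j + 1 := x (j + 1) - 1)"
    using lj by (auto simp: l2_def l1_def x_def fun_eq_iff)
  then have "vandermonde n (\<lambda>i. real (l2 i)) = vandermonde n x * (\<Prod>i \<in> {1..n} - {j, j + 1}. r i)"
    using vandermonde_lower_adjacent[OF j] by (simp add: x_def l_def r_def)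
  also have "{1..n} - {j, j + 1} = (\<lambda>t. j - t) ` {1..p} \<union> (\<lambda>t. j + 1 + t) ` {1..Suc q}"
  proof (intro equalityI subsetI)
    fix i assume i: "i \<in> {1..n} - {j, j + 1}"
    show "i \<in> (\<lambda>t. j - t) ` {1..p} \<union> (\<lambda>t. j + 1 + t) ` {1..Suc q}"
    proof (cases "i < j")
      case True
      then have "i = j - (j - i)" "j - i \<in> {1..p}" using i p by auto
      then show ?thesis by blast
    next
      case False
      then have "i = j + 1 + (i - (j + 1))" "i - (j + 1) \<in> {1..Suc q}" using i q by auto
      then show ?thesis by blast
    qed
  qed (auto simp: p q)
  also have "prod r \<dots> = prod r ((\<lambda>t. j - t) ` {1..p}) * prod r ((\<lambda>t. j + 1 + t) ` {1..Suc q})"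
    by (rule prod.union_disjoint) (auto simp: p)
  also have "prod r ((\<lambda>t. j - t) ` {1..p}) = (\<Prod>t = 1..p. r (j - t))"
    by (subst prod.reindex) (auto simp: p inj_on_def)
  also have "\<dots> = (\<Prod>t = 1..p. (2 * real t + 1) * (2 * real t + 3) / (2 * real t * (2 * real t + 2)))"
  proof (intro prod.cong refl)
    fix t assume "t \<in> {1..p}"
    then have "x (j - t) = x j + 2 * real t" "x (j + 1) = x j - 2" "0 < t"
      by (auto simp: x_def l_def p q of_nat_diff)
    then show "r (j - t) = (2 * real t + 1) * (2 * real t + 3) / (2 * real t * (2 * real t + 2))"
      by (simp add: r_def divide_simps) (simp add: algebra_simps)
  qed
  also have "prod r ((\<lambda>t. j + 1 + t) ` {1..Suc q}) = (\<Prod>t = 1..Suc q. r (j + 1 + t))"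
    by (subst prod.reindex) (auto simp: inj_on_def)
  also have "\<dots> = (\<Prod>t = 1..Suc q. (2 * real t + 1) * (2 * real t - 1) / (2 * real t * (2 * real t + 2)))"
  proof (intro prod.cong refl)
    fix t assume "t \<in> {1..Suc q}"
    then have "x (j + 1 + t) = x j - 2 - 2 * real t" "x (j + 1) = x j - 2" "0 < t"
      by (auto simp: x_def l_def q of_nat_diff)
    then show "r (j + 1 + t) = (2 * real t + 1) * (2 * real t - 1) / (2 * real t * (2 * real t + 2))"
      by (simp add: r_def divide_simps) (simp add: algebra_simps)
  qed
  finally have V: "vandermonde n (\<lambda>i. real (l2 i)) = vandermonde n x *
      ((real (double_fact (2 * p + 1)) * real (double_fact (2 * p + 3)) / (3 * 4 ^ p * fact p * fact (p + 1))) *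
       (real (double_fact (2 * Suc q + 1)) * real (double_fact (2 * Suc q - 1)) /
         (4 ^ Suc q * fact (Suc q) * fact (Suc q + 1))))"
    unfolding prod_odd_even_up prod_odd_even_down .
  have l2: "l2 = (\<lambda>i. 2 * (n - i))(j := 2 * (n - j) - 1, j + 1 := 2 * (n - (j + 1)) - 1)"
    by (auto simp: l2_def l1_def l_def)
  have idx: "2 * j - 1 = 2 * p + 1" "2 * j + 1 = 2 * p + 3" "j - 1 = p" "j = p + 1"
    "2 * n - 2 * j - 3 = 2 * Suc q - 1" "2 * n - 2 * j - 1 = 2 * Suc q + 1" "n - j - 2 = q" "n - j - 1 = Suc q"
    "n - 3 = p + q"
    by (simp_all add: p q)
  define F where "F = (\<Prod>k = 1..n. fact (l2 k) :: real)"
  have F: "F \<noteq> 0" by (simp add: F_def)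
  define D1 D2 D3 D4 where D: "D1 = real (double_fact (2 * p + 1))" "D2 = real (double_fact (2 * p + 3))"
    "D3 = real (double_fact (2 * Suc q - 1))" "D4 = real (double_fact (2 * Suc q + 1))"
  have "frobenius_weight n l2 = vandermonde n x * (D1 * D2 / (3 * 4 ^ p * fact p * fact (p + 1)) *
       (D4 * D3 / (4 ^ Suc q * fact (Suc q) * fact (Suc q + 1)))) / F"
    unfolding frobenius_weight_def V F_def D ..
  \<comment> \<open>The factor (2q + 4)(2q + 2) = 4(q + 2)(q + 1) from the lowered factorials
    reduces \<open>4 ^ Suc q\<close>, \<open>fact (Suc q + 1)\<close> and
    \<open>fact (Suc q)\<close> by one step each.\<close>
  also have "\<dots> = vandermonde n x / ((2 * real q + 4) * (2 * real q + 2) * F) / (3 * 4 ^ (p + q)) *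
      (D1 / fact p * (D2 / fact (p + 1)) * (D3 / fact q) * (D4 / fact (Suc q)))"
    using F by (simp add: divide_simps power_add) (simp add: algebra_simps)
  also have "vandermonde n x / ((2 * real q + 4) * (2 * real q + 2) * F) = frobenius_weight n l"
    unfolding frobenius_weight_def fact F_def x_def ..
  finally show ?thesis
    unfolding l2[symmetric] idx(1-3,5-) unfolding D l_def idx(4)[symmetric] .
qed

theorem theorem2p7:
  fixes n :: nat
  assumes "n \<ge> 3"
  shows "measure_pmf.expectation (pmf_of_set (reduced_words n (longest_element n)))
           (\<lambda>u. real (num_commutations u)) =
         real (n choose 2) - 1
         - 1 / (3 * real (n choose 2) * 2 powi (2 * int n - 7))
           * (\<Sum>j = 1..n - 2.
                real (double_fact (2 * j - 1)) / fact (j - 1)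
              * (real (double_fact (2 * j + 1)) / fact j)
              * (real (double_fact (2 * n - 2 * j - 3)) / fact (n - j - 2))
              * (real (double_fact (2 * n - 2 * j - 1)) / fact (n - j - 1)))"
    (is "_ = real (n choose 2) - 1 - _ * (\<Sum>j = 1..n - 2. ?T j)")
proof -
  define L where "L = n choose 2"
  define w where "w = longest_element n"
  define W where "W = words_of_length n L w"
  define G where "G = frobenius_weight n (\<lambda>i. 2 * (n - i))"
  define N where "N k = card {u \<in> W. \<not> supports_commutation u k}" for k
  define S where "S = (\<Sum>j = 1..n - 2. ?T j)"
  obtain k where "n = Suc (Suc (Suc k))" using assms by (metis numeral_3_eq_3 Suc_le_D Suc_le_mono)
  then obtain m where m: "L = Suc (Suc m)" by (simp add: L_def numeral_2_eq_2)
  have inv: "card (inversions n w) = L" by (simp add: L_def w_def card_inversions_longest)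
  have w: "w permutes {1..n}" unfolding w_def by (rule longest_element_permutes)
  obtain e where e: "schubert n id e" using schubert_ex1[OF permutes_id] by blast
  define E where "E = poly_weight n e"
  have top: "schubert n w (frag_of (staircase n))" unfolding w_def by (rule schubert.longest)
  have count: "real (card (words_of_length n l v)) * E = fact l * poly_weight n f"
    if "schubert n v f" "card (inversions n v) = l" for v f l
    unfolding E_def using assms by (intro card_words_poly_weight e that) simp
  have cardW: "real (card W) * E = fact L * G"
    using count[OF top inv] unfolding W_def G_def poly_weight_staircase .
  have G: "G \<noteq> 0" unfolding G_def by (rule frobenius_weight_nonzero)
  \<comment> \<open>One nonzero product yields both that the normalising constant can be cancelled
    and that words of length \<open>L\<close> exist.\<close>
  have "real (card W) * E \<noteq> 0" unfolding cardW using G by simp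
  then have E: "E \<noteq> 0" and cardW0: "card W \<noteq> 0" by auto
  then have finW: "finite W" "W \<noteq> {}" by (auto simp: W_def)
  have two: "real (card (words_of_length n m (w \<circ> simple_reflection j \<circ> simple_reflection k))) * E =
      fact m * frobenius_weight n ((\<lambda>i. 2 * (n - i))(j := 2 * (n - j) - 1, k := 2 * (n - k) - 1))"
    if j: "1 \<le> j" "j < n" and k: "1 \<le> k" "k < n" and jk: "k = j + 1 \<or> j = k + 1" for j k
  proof -
    have dj: "w (j + 1) < w j" unfolding w_def by (rule longest_element_descent[OF j])
    have "(w \<circ> simple_reflection j) (k + 1) < (w \<circ> simple_reflection j) k"
      using j k jk by (auto simp: w_def simple_reflection_apply longest_element_def)
    note dk = this
    note s1 = schubert.step[OF top j dj]
    have "card (inversions n (w \<circ> simple_reflection j \<circ> simple_reflection k)) = m"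
      using card_inversions_descent[OF j dj] card_inversions_descent[OF k dk] inv m by linarith
    note c = count[OF schubert.step[OF s1 k dk] this]
    have "j \<noteq> k" using jk by auto
    from c show ?thesis unfolding poly_weight_staircase_lower2[OF j k \<open>j \<noteq> k\<close>] .
  qed
  have NE: "real (N (L - 1)) * E = 2 * fact m * G / (3 * 4 ^ (n - 3)) * S"
  proof -
    have "real (N (L - 1)) * E =
        (\<Sum>j = 1..n - 2. real (card (words_of_length n m (w \<circ> simple_reflection j \<circ> simple_reflection (j + 1)))) * E
          + real (card (words_of_length n m (w \<circ> simple_reflection (j + 1) \<circ> simple_reflection j))) * E)"
      unfolding N_def W_def card_not_supports_commutation_last[OF m inv[symmetric]]
      by (simp only: of_nat_sum of_nat_add sum_distrib_right distrib_right)
    also have "\<dots> = (\<Sum>j = 1..n - 2. 2 * fact m * G / (3 * 4 ^ (n - 3)) * ?T j)"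
    proof (intro sum.cong refl)
      fix j assume "j \<in> {1..n - 2}"
      then have j: "1 \<le> j" "j + 1 < n" by auto
      let ?l = "(\<lambda>i. 2 * (n - i))(j := 2 * (n - j) - 1, j + 1 := 2 * (n - (j + 1)) - 1)"
      \<comment> \<open>Both orders of the two letters lower the same entries, hence the factor
        2.\<close>
      have "(\<lambda>i. 2 * (n - i))(j + 1 := 2 * (n - (j + 1)) - 1, j := 2 * (n - j) - 1) = ?l"
        by (rule fun_upd_twist) simp
      then have "real (card (words_of_length n m (w \<circ> simple_reflection j \<circ> simple_reflection (j + 1)))) * E
          + real (card (words_of_length n m (w \<circ> simple_reflection (j + 1) \<circ> simple_reflection j))) * E =
          2 * fact m * frobenius_weight n ?l"
        using two[of j "j + 1"] two[of "j + 1" j] j by simp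
      then show "real (card (words_of_length n m (w \<circ> simple_reflection j \<circ> simple_reflection (j + 1)))) * E
          + real (card (words_of_length n m (w \<circ> simple_reflection (j + 1) \<circ> simple_reflection j))) * E =
          2 * fact m * G / (3 * 4 ^ (n - 3)) * ?T j"
        unfolding frobenius_weight_lower_adjacent[OF j] G_def by (simp only: times_divide_eq_right times_divide_eq_left mult.assoc)
    qed
    finally show ?thesis by (simp only: S_def sum_distrib_left)
  qed
  \<comment> \<open>Passing from words of length \<open>L\<close> to length \<open>m = L - 2\<close>
    costs L(L - 1); the factor L - 1 later cancels against the number of positions.\<close>
  have "real L * (real L - 1) * fact m = (fact L :: real)"
    by (simp add: m algebra_simps)
  then have "real (card W) * E = real L * (real L - 1) * fact m * G"
    unfolding cardW by simp
  then have "real L * (real L - 1) * (real (N (L - 1)) * E) = 2 * (real (card W) * E) / (3 * 4 ^ (n - 3)) * S"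
    unfolding NE by (simp only: times_divide_eq_right times_divide_eq_left mult_ac)
  then have "(real L * (real L - 1) * real (N (L - 1))) * E = (2 * real (card W) / (3 * 4 ^ (n - 3)) * S) * E"
    by (simp only: times_divide_eq_right times_divide_eq_left mult_ac)
  then have NW: "real L * (real L - 1) * real (N (L - 1)) = 2 * real (card W) / (3 * 4 ^ (n - 3)) * S"
    by (rule iffD1[OF mult_right_cancel[OF E]])
  have N: "N k = N (L - 1)" if "k \<in> {1..L - 1}" for k
    unfolding N_def W_def w_def using that by (intro card_not_supports_commutation) auto
  have num: "real (num_commutations u) = (\<Sum>k = 1..L - 1. of_bool (supports_commutation u k))" if "u \<in> W" for u
  proof -
    have "length u = L" using that by (simp add: W_def words_of_length_def)
    moreover have "{k \<in> {1..L - 1}. supports_commutation u k} = {1..L - 1} \<inter> {k. supports_commutation u k}"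
      by blast
    ultimately show ?thesis
      unfolding num_commutations_def of_bool_def by (simp add: sum.If_cases)
  qed
  have "(\<Sum>u \<in> W. real (num_commutations u)) = (\<Sum>u \<in> W. \<Sum>k = 1..L - 1. of_bool (supports_commutation u k))"
    using num by (rule sum.cong[OF refl])
  also have "\<dots> = (\<Sum>k = 1..L - 1. \<Sum>u \<in> W. of_bool (supports_commutation u k))"
    by (rule sum.swap)
  also have "\<dots> = (\<Sum>k = 1..L - 1. real (card W) - real (N (L - 1)))"
  proof (intro sum.cong refl)
    fix k assume k: "k \<in> {1..L - 1}"
    have "(\<Sum>u \<in> W. of_bool (supports_commutation u k)) = (\<Sum>u \<in> W. 1 - of_bool (\<not> supports_commutation u k) :: real)"
      by (intro sum.cong) auto
    also have "\<dots> = real (card W) - real (card (W \<inter> {u. \<not> supports_commutation u k}))"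
      using finW unfolding sum_subtractf of_bool_def by (simp add: sum.If_cases)
    also have "W \<inter> {u. \<not> supports_commutation u k} = {u \<in> W. \<not> supports_commutation u k}"
      by blast
    also have "real (card W) - real (card \<dots>) = real (card W) - real (N k)"
      by (simp add: N_def)
    finally show "(\<Sum>u \<in> W. of_bool (supports_commutation u k)) = real (card W) - real (N (L - 1))"
      using N[OF k] by simp
  qed
  also have "\<dots> = (real L - 1) * (real (card W) - real (N (L - 1)))"
    by (simp add: m)
  finally have sum: "(\<Sum>u \<in> W. real (num_commutations u)) = \<dots>" .
  have "reduced_words n (longest_element n) = W"
    using reduced_words_longest[of n] finW(2) by (simp add: W_def w_def L_def)
  then have "measure_pmf.expectation (pmf_of_set (reduced_words n (longest_element n))) (\<lambda>u. real (num_commutations u)) =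
      (real L - 1) * (real (card W) - real (N (L - 1))) / real (card W)"
    using finW by (simp add: integral_pmf_of_set sum)
  also have "\<dots> = real L - 1 - 2 / (3 * real L * 4 ^ (n - 3)) * S"
  proof -
    have "real L \<noteq> 0" "real (card W) \<noteq> 0" using m cardW0 by auto
    moreover from this have "(real L - 1) * real (N (L - 1)) = 2 * real (card W) / (3 * 4 ^ (n - 3)) * S / real L"
      using NW by (simp add: eq_divide_eq mult_ac)
    ultimately show ?thesis
      by (simp add: right_diff_distrib diff_divide_distrib)
  qed
  \<comment> \<open>The exponent 2n - 7 is -1 for n = 3, so this step needs integer powers.\<close>
  also have "2 / (3 * real L * 4 ^ (n - 3)) = 1 / (3 * real L * 2 powi (2 * int n - 7))"
  proof -
    have "(2::real) * 2 powi (2 * int n - 7) = 2 powi (2 * int n - 6)"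
      using power_int_add_1'[of "2::real" "2 * int n - 7"] by simp
    also have "2 * int n - 6 = int (2 * (n - 3))" using assms by simp
    also have "(2::real) powi int (2 * (n - 3)) = 4 ^ (n - 3)"
      by (simp only: power_int_of_nat power_mult) simp
    finally have "4 ^ (n - 3) = (2::real) * 2 powi (2 * int n - 7)" ..
    then show ?thesis by simp
  qed
  finally show ?thesis by (simp only: L_def S_def)
qed

end
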